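(* Let $(X,d,\mu)$ be a connected and locally connected metric probability space, and let $\delta,\varepsilon>0$. Then there is an integer $q$, depending only on $(X,d,\mu)$, $\delta$ and $\varepsilon$, such that the following holds for every $N\geq1$. If $A,B\subseteq X^N$ are Borel sets such that \[\inf\{d^N_\infty(x,y)\mid x\in A,\ y\in B\}\geq\delta,\] then there are a set $S\subseteq[N]$ with $|S|\leq q$, and Borel subsets $A',B'\subseteq X^N$ that depend only on coordinates in $S$, such that $\mu^N(A\setminus A')<\varepsilon$, $\mu^N(B\setminus B')<\varepsilon$ and \[\inf\{d^N_\infty(x,y)\mid x\in A',\ y\in B'\}\geq\delta-\varepsilon.\]
   Context: A metric probability space is a triple $(X,d,\mu)$ where $d$ is a compact metric on $X$ and $\mu$ is a probability measure on the Borel $\sigma$-algebra of $(X,d)$. It is called connected (resp. locally connected) if the support $\mathrm{spt}\,\mu$ is connected (resp. locally connected). $\mu^N$ is the $N$-fold product measure on $X^N$, $[N]=\{1,\ldots,N\}$, and $d^N_\infty(x,y):=\max_{n\leq N}d(x_n,y_n)$. A subset $A'\subseteq X^N$ depends only on coordinates in $S$ if, whenever $x,y\in X^N$ satisfy $x_n=y_n$ for all $n\in S$, one has $x\in A'$ if and only if $y\in A'$. The infimum over the empty set is $+\infty$. *)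

theory Defs
  imports "HOL-Probability.Probability"
begin

text \<open>
  The underlying set \<open>X\<close> is the whole type \<open>'a\<close>, whose metric \<open>dist\<close> plays the role of \<open>d\<close>;
  \<open>\<mu>\<close> is a measure on the Borel sets of \<open>'a\<close>.
\<close>

definition metric_prob_space :: "'a::metric_space measure \<Rightarrow> bool" where
  "metric_prob_space \<mu> \<longleftrightarrow>
     compact (UNIV :: 'a set) \<and> prob_space \<mu> \<and> sets \<mu> = sets borel"

definition spt :: "'a::topological_space measure \<Rightarrow> 'a set" where
  "spt \<mu> = {x. \<forall>U. open U \<and> x \<in> U \<longrightarrow> emeasure \<mu> U > 0}"

text \<open>
  Points of \<open>X\<^sup>N\<close> are functions \<open>nat \<Rightarrow> 'a\<close> that are \<open>undefined\<close> outside \<open>{1..N}\<close>.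
\<close>

definition pow_space :: "nat \<Rightarrow> (nat \<Rightarrow> 'a) set" where
  "pow_space N = PiE {1..N} (\<lambda>_. UNIV)"

definition pow_borel :: "nat \<Rightarrow> (nat \<Rightarrow> 'a::topological_space) set set" where
  "pow_borel N = sigma_sets (pow_space N)
     {U. openin (product_topology (\<lambda>_. euclidean) {1..N}) U}"

text \<open>
  The product measure lives a priori on the product \<open>\<sigma>\<close>-algebra, which agrees with
  \<open>pow_borel N\<close> for compact \<open>X\<close>: see \<open>sets_pow_measure\<close> below.
\<close>

definition pow_measure :: "nat \<Rightarrow> 'a measure \<Rightarrow> (nat \<Rightarrow> 'a) measure" where
  "pow_measure N \<mu> = PiM {1..N} (\<lambda>_. \<mu>)"

definition dist_max :: "nat \<Rightarrow> (nat \<Rightarrow> 'a::metric_space) \<Rightarrow> (nat \<Rightarrow> 'a) \<Rightarrow> real" where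
  "dist_max N x y = Max ((\<lambda>n. dist (x n) (y n)) ` {1..N})"

text \<open>Taken in the extended reals, so that an infimum over the empty set is \<open>\<infinity>\<close>.\<close>

definition set_dist_max ::
  "nat \<Rightarrow> (nat \<Rightarrow> 'a::metric_space) set \<Rightarrow> (nat \<Rightarrow> 'a) set \<Rightarrow> ereal" where
  "set_dist_max N A B = Inf {ereal (dist_max N x y) | x y. x \<in> A \<and> y \<in> B}"

definition depends_only_on :: "nat \<Rightarrow> nat set \<Rightarrow> (nat \<Rightarrow> 'a) set \<Rightarrow> bool" where
  "depends_only_on N S A \<longleftrightarrow>
     (\<forall>x \<in> pow_space N. \<forall>y \<in> pow_space N. (\<forall>n \<in> S. x n = y n) \<longrightarrow> (x \<in> A \<longleftrightarrow> y \<in> A))"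

lemma compact_countable_basis:
  assumes "compact (UNIV :: 'a::metric_space set)"
  obtains \<B> :: "'a::metric_space set set" where "countable \<B>" "\<And>V. V \<in> \<B> \<Longrightarrow> open V"
    "\<And>U x. open U \<Longrightarrow> x \<in> U \<Longrightarrow> \<exists>V\<in>\<B>. x \<in> V \<and> V \<subseteq> U"
proof -
  have "\<forall>n::nat. \<exists>k. finite k \<and> (UNIV :: 'a set) \<subseteq> (\<Union>x\<in>k. ball x (1 / Suc n))"
    using assms unfolding compact_eq_totally_bounded by simp
  then obtain k where k: "\<And>n. finite (k n)"
    "\<And>n::nat. (UNIV :: 'a set) \<subseteq> (\<Union>x\<in>k n. ball x (1 / Suc n))"
    by metis
  define \<B> where "\<B> = (\<Union>n. (\<lambda>x. ball x (1 / Suc n)) ` k n)"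
  show thesis
  proof
    show "countable \<B>"
      unfolding \<B>_def using k(1) by (intro countable_UN countable_image) (auto intro: countable_finite)
    show "open V" if "V \<in> \<B>" for V
      using that by (auto simp: \<B>_def)
    show "\<exists>V\<in>\<B>. x \<in> V \<and> V \<subseteq> U" if U: "open U" "x \<in> U" for U x
    proof -
      obtain e where e: "e > 0" "ball x e \<subseteq> U"
        using U open_contains_ball by blast
      obtain n where n: "1 / real (Suc n) < e / 2"
        using e nat_approx_posE[of "e / 2"] by auto
      obtain y where y: "y \<in> k n" "x \<in> ball y (1 / Suc n)"
        using k(2)[of n] by blast
      have "ball y (1 / Suc n) \<subseteq> ball x e"
      proof
        fix z assume "z \<in> ball y (1 / Suc n)"
        then have "dist y z < e / 2" "dist y x < e / 2"
          using y n by auto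
        then show "z \<in> ball x e"
          using dist_triangle[of x z y] by (simp add: dist_commute)
      qed
      then show ?thesis
        using y e by (auto simp: \<B>_def)
    qed
  qed
qed

lemma sets_pow_measure:
  assumes "metric_prob_space (\<mu> :: 'a::metric_space measure)"
  shows "sets (pow_measure N \<mu>) = pow_borel N"
proof -
  let ?I = "{1..N}" and ?T = "product_topology (\<lambda>_. euclidean :: 'a topology) {1..N}"
  have sets: "sets \<mu> = sets borel"
    using assms by (simp add: metric_prob_space_def)
  have space: "space \<mu> = UNIV"
    using sets_eq_imp_space_eq[OF sets] by simp
  obtain \<B> :: "'a set set" where \<B>: "countable \<B>" "\<And>V. V \<in> \<B> \<Longrightarrow> open V"
    "\<And>U x. open U \<Longrightarrow> x \<in> U \<Longrightarrow> \<exists>V\<in>\<B>. x \<in> V \<and> V \<subseteq> U"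
    using assms compact_countable_basis unfolding metric_prob_space_def by blast
  have PiM: "sets (pow_measure N \<mu>) = sets (PiM ?I (\<lambda>_. borel :: 'a measure))"
    unfolding pow_measure_def by (intro sets_PiM_cong) (auto simp: sets)
  have "U \<in> sets (PiM ?I (\<lambda>_. borel))" if U: "openin ?T U" for U
  proof -
    define \<C> where "\<C> = PiE ?I ` {W \<in> PiE ?I (\<lambda>_. \<B>). PiE ?I W \<subseteq> U}"
    have "countable (PiE ?I (\<lambda>_. \<B>))"
      using \<B>(1) by (intro countable_PiE) auto
    then have "countable (PiE ?I ` PiE ?I (\<lambda>_. \<B>))"
      by (rule countable_image)
    then have "countable \<C>"
      by (rule countable_subset[rotated]) (auto simp: \<C>_def)
    moreover have "C \<in> sets (PiM ?I (\<lambda>_. borel))" if C: "C \<in> \<C>" for C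
    proof -
      obtain W where W: "C = PiE ?I W" "W \<in> PiE ?I (\<lambda>_. \<B>)"
        using C unfolding \<C>_def image_iff by (metis (mono_tags, lifting) mem_Collect_eq)
      have "W i \<in> sets borel" if "i \<in> ?I" for i
        using \<B>(2)[OF PiE_mem[OF W(2) that]] by simp
      then show ?thesis
        unfolding W(1) by (intro sets_PiM_I_finite) auto
    qed
    ultimately have "\<Union>\<C> \<in> sets (PiM ?I (\<lambda>_. borel))"
      by (intro sets.countable_Union subsetI)
    moreover have "\<Union>\<C> = U"
    proof
      show "\<Union>\<C> \<subseteq> U" by (auto simp: \<C>_def)
      show "U \<subseteq> \<Union>\<C>"
      proof
        fix x assume x: "x \<in> U"
        with U[unfolded openin_product_topology_alt] obtain V
          where "\<forall>i\<in>?I. openin euclidean (V i)" and V: "x \<in> PiE ?I V" "PiE ?I V \<subseteq> U"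
          by blast
        then have V_open: "open (V i)" if "i \<in> ?I" for i
          using that by simp
        have "\<forall>i\<in>?I. \<exists>W\<in>\<B>. x i \<in> W \<and> W \<subseteq> V i"
          using \<B>(3)[OF V_open PiE_mem[OF V(1)]] by blast
        then obtain W where "\<forall>i\<in>?I. W i \<in> \<B> \<and> x i \<in> W i \<and> W i \<subseteq> V i"
          using bchoice[of ?I "\<lambda>i W. W \<in> \<B> \<and> x i \<in> W \<and> W \<subseteq> V i"] by blast
        then have W: "\<And>i. i \<in> ?I \<Longrightarrow> W i \<in> \<B> \<and> x i \<in> W i \<and> W i \<subseteq> V i"
          by blast
        define W' where "W' = restrict W ?I"
        have "W' \<in> PiE ?I (\<lambda>_. \<B>)" "x \<in> PiE ?I W'"
          using W V(1) by (auto simp: W'_def PiE_iff)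
        moreover have "PiE ?I W' \<subseteq> PiE ?I V"
          using W by (intro PiE_mono) (auto simp: W'_def)
        ultimately show "x \<in> \<Union>\<C>"
          using V(2) by (intro UnionI[of "PiE ?I W'"]) (simp_all add: \<C>_def)
      qed
    qed
    ultimately show ?thesis by simp
  qed
  moreover have "space (PiM ?I (\<lambda>_. borel :: 'a measure)) = pow_space N"
    by (simp add: space_PiM pow_space_def)
  ultimately have "pow_borel N \<subseteq> sets (PiM ?I (\<lambda>_. borel :: 'a measure))"
    unfolding pow_borel_def
    using sets.sigma_sets_subset[of "{U. openin ?T U}" "PiM ?I (\<lambda>_. borel :: 'a measure)"] by auto
  moreover have "sets (PiM ?I (\<lambda>_. borel :: 'a measure)) \<subseteq> pow_borel N"
  proof -
    define \<S> where "\<S> = sigma (pow_space N) {U. openin ?T U}"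
    have sub: "{U. openin ?T U} \<subseteq> Pow (pow_space N)"
      using openin_subset by (fastforce simp: pow_space_def)
    have \<S>: "space \<S> = pow_space N" "sets \<S> = pow_borel N"
      using sub by (auto simp: \<S>_def pow_borel_def)
    have "(\<lambda>x. x i) \<in> measurable \<S> borel" if i: "i \<in> ?I" for i
    proof (rule borel_measurableI)
      fix U :: "'a set" assume "open U"
      then have "openin ?T {x \<in> topspace ?T. x i \<in> U}"
        by (intro openin_continuous_map_preimage[OF continuous_map_product_projection[OF i]])
           simp
      moreover have "(\<lambda>x. x i) -` U \<inter> space \<S> = {x \<in> topspace ?T. x i \<in> U}"
        by (auto simp: \<S> pow_space_def)
      ultimately show "(\<lambda>x. x i) -` U \<inter> space \<S> \<in> sets \<S>"
        unfolding \<S> pow_borel_def by auto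
    qed
    then have "(\<lambda>x. \<lambda>i\<in>?I. x i) \<in> measurable \<S> (PiM ?I (\<lambda>_. borel))"
      by (rule measurable_restrict)
    then have id: "(\<lambda>x. x) \<in> measurable \<S> (PiM ?I (\<lambda>_. borel))"
      by (rule measurable_cong[THEN iffD1, rotated]) (auto simp: \<S> pow_space_def)
    show ?thesis
    proof
      fix A assume A: "A \<in> sets (PiM ?I (\<lambda>_. borel :: 'a measure))"
      then have "A \<subseteq> pow_space N"
        using sets.sets_into_space by (fastforce simp: space_PiM pow_space_def)
      then show "A \<in> pow_borel N"
        using measurable_sets[OF id A] by (simp add: \<S> Int_absorb2)
    qed
  qed
  ultimately show ?thesis
    using PiM by auto
qed

end

theory Submission
  imports Defs
begin

text \<open>
  Cover almost all of \<open>X\<close> by finitely many small disjoint cells. Since \<open>spt \<mu>\<close> is connected, some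
  walk with small steps visits every cell; distributing the mass of a cell over its visits, \<open>\<mu>\<close>
  becomes a probability with full support on a finite path, and \<open>X\<^sup>N\<close> becomes a power of that path.
  Each vertex of the path is subdivided into a block of \<open>R\<close> sites, \<open>R \<ge> N\<close>.

  For a set \<open>A\<close> let \<open>F\<close> be the truncated \<open>\<ell>\<^sup>\<infinity>\<close>-distance to \<open>A\<close>, measured in units of \<open>R\<close> sites. Replacing
  \<open>F\<close> by its maximum over the moves of one site in all coordinates raises it by at most \<open>1/R\<close>. Performed
  one coordinate after the other, this gains at least a constant times \<open>1/R\<close> of the oscillation in each
  coordinate, so the mean oscillations of \<open>F\<close> have a sum bounded independently of \<open>N\<close>.

  The block average \<open>H\<close> of \<open>F\<close> keeps this bound and lives on a product of finite spaces with
  point masses bounded below, where a logarithmic Sobolev inequality holds with a constant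
  independent of \<open>N\<close>. Applied to martingale differences of \<open>H\<close>, it shows (as in Friedgut's
  theorem, with the proof of Falik and Samorodnitsky) that \<open>H\<close> is close in \<open>L\<^sup>2\<close> to its conditional
  expectation on the boundedly many coordinates of large mean oscillation.

  Since \<open>H = 0\<close> on \<open>A\<close> and \<open>H < 1\<close> only near \<open>A\<close>, the set \<open>A'\<close> where the conditional expectation is
  below \<open>1/2\<close> contains most of \<open>A\<close>; and points of \<open>A'\<close> and \<open>B'\<close> have a common completion outside \<open>S\<close>
  that is near \<open>A\<close> and near \<open>B\<close> respectively.
\<close>

section \<open>Entropy inequalities for finite weighted sums\<close>

lemma weighted_sum_eq_0D:
  fixes a u :: "'i \<Rightarrow> real"
  assumes "finite I" "\<And>i. i \<in> I \<Longrightarrow> 0 < u i" "\<And>i. i \<in> I \<Longrightarrow> 0 \<le> a i"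
    and "(\<Sum>i\<in>I. u i * a i) = 0" and i: "i \<in> I"
  shows "a i = 0"
proof -
  have "\<forall>i\<in>I. u i * a i = 0"
    using assms by (subst (asm) sum_nonneg_eq_0_iff) (auto simp: less_imp_le)
  then show ?thesis using i assms(2)[OF i] by auto
qed

text \<open>The inequality \<open>ln t \<le> t - 1\<close> at \<open>t = b * (A / B) / a\<close>,
  multiplied by \<open>a\<close>. The linear terms cancel in a weighted sum in which the
  \<open>a\<close> have total \<open>A\<close> and the \<open>b\<close> have total
  \<open>B\<close>.\<close>

lemma log_sum_pointwise:
  fixes a b A B :: real
  assumes "0 \<le> a" "0 \<le> b" "b = 0 \<Longrightarrow> a = 0" "0 < A" "0 < B"
  shows "a * ln (A / B) + a - b * (A / B) \<le> a * ln a - a * ln b"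
proof (cases "a = 0")
  case True
  then show ?thesis using assms by simp
next
  case False
  then have a: "0 < a" "0 < b" using assms by (auto simp: order_less_le)
  define t where "t = b * (A / B) / a"
  have t: "0 < t" using a assms by (simp add: t_def)
  have "ln t = ln b + ln (A / B) - ln a"
    unfolding t_def using a assms by (simp add: ln_div ln_mult)
  moreover have "a * ln t \<le> a * (t - 1)"
    using a t by (intro mult_left_mono ln_le_minus_one) auto
  moreover have "a * (t - 1) = b * (A / B) - a"
    using a by (simp add: t_def field_simps)
  ultimately have "a * (ln b + ln (A / B) - ln a) \<le> b * (A / B) - a" by simp
  then show ?thesis by (simp only: distrib_left right_diff_distrib)
qed

text \<open>Sum \<open>log_sum_pointwise\<close>; the totals make its linear terms vanish. As
  \<open>ln 0 = 0\<close>, hypothesis \<open>ab\<close> excludes the terms that ought to be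
  infinite.\<close>

lemma log_sum_ineq:
  fixes a b u :: "'i \<Rightarrow> real"
  assumes I: "finite I" and u: "\<And>i. i \<in> I \<Longrightarrow> 0 < u i"
    and a: "\<And>i. i \<in> I \<Longrightarrow> 0 \<le> a i" and b: "\<And>i. i \<in> I \<Longrightarrow> 0 \<le> b i"
    and ab: "\<And>i. i \<in> I \<Longrightarrow> b i = 0 \<Longrightarrow> a i = 0"
  defines "A \<equiv> \<Sum>i\<in>I. u i * a i" and "B \<equiv> \<Sum>i\<in>I. u i * b i"
  shows "A * ln A - A * ln B \<le> (\<Sum>i\<in>I. u i * (a i * ln (a i) - a i * ln (b i)))"
proof (cases "A = 0")
  case True
  then have "a i = 0" if "i \<in> I" for i
    using weighted_sum_eq_0D[of I u a i] I u a that by (simp add: A_def)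
  then show ?thesis using True by simp
next
  case False
  have "0 \<le> A" unfolding A_def using u a by (intro sum_nonneg mult_nonneg_nonneg) (auto intro: less_imp_le)
  with False have A: "0 < A" by simp
  have "0 \<le> B" unfolding B_def using u b by (intro sum_nonneg mult_nonneg_nonneg) (auto intro: less_imp_le)
  moreover have "B \<noteq> 0"
  proof
    assume "B = 0"
    then have "b i = 0" if "i \<in> I" for i
      using weighted_sum_eq_0D[of I u b i] I u b that by (simp add: B_def)
    then have "A = 0" unfolding A_def using ab by simp
    with False show False ..
  qed
  ultimately have B: "0 < B" by simp
  have lin: "(\<Sum>i\<in>I. u i * (a i * c + a i - b i * d)) = A * c + A - B * d" for c d
    by (simp add: A_def B_def algebra_simps sum.distrib sum_subtractf sum_distrib_left)
  have "A * ln A - A * ln B = A * ln (A / B) + A - B * (A / B)"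
    using A B by (simp add: ln_div algebra_simps)
  also have "\<dots> = (\<Sum>i\<in>I. u i * (a i * ln (A / B) + a i - b i * (A / B)))"
    by (rule lin[symmetric])
  also have "\<dots> \<le> (\<Sum>i\<in>I. u i * (a i * ln (a i) - a i * ln (b i)))"
    using u a b ab A B
    by (intro sum_mono mult_left_mono log_sum_pointwise) (auto intro: less_imp_le)
  finally show ?thesis .
qed

text \<open>By \<open>ln t \<le> t - 1\<close>, the entropy of \<open>g\<^sup>2\<close> is at most
  its variance divided by \<open>Q\<close>. That variance is at most the mean of
  \<open>(g - m)\<^sup>2 * (g + m)\<^sup>2\<close>, where the last hypothesis bounds the first
  factor by \<open>v / l\<close>, and the second has mean
  \<open>Q + 3 * m\<^sup>2 \<le> 4 * Q\<close>. Asking for this hypothesis, and not for point masses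
  of at least \<open>l\<close>, allows a constant free of \<open>R\<close> later.\<close>

lemma log_sobolev_one_site:
  fixes g u :: "'i \<Rightarrow> real"
  assumes I: "finite I" and u: "\<And>i. i \<in> I \<Longrightarrow> 0 < u i" "(\<Sum>i\<in>I. u i) = 1" and l: "0 < l"
  defines "m \<equiv> \<Sum>i\<in>I. u i * g i" and "Q \<equiv> \<Sum>i\<in>I. u i * (g i)\<^sup>2"
  defines "v \<equiv> \<Sum>i\<in>I. u i * (g i - (\<Sum>i\<in>I. u i * g i))\<^sup>2"
  assumes g: "\<And>i. i \<in> I \<Longrightarrow> l * (g i - m)\<^sup>2 \<le> v"
  shows "(\<Sum>i\<in>I. u i * ((g i)\<^sup>2 * ln ((g i)\<^sup>2))) - Q * ln Q \<le> 4 / l * v"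
proof (cases "Q = 0")
  case True
  then have "g i = 0" if "i \<in> I" for i
    using weighted_sum_eq_0D[of I u "\<lambda>i. (g i)\<^sup>2" i] I u that by (simp add: Q_def)
  then show ?thesis using True by (simp add: v_def)
next
  case False
  have "0 \<le> Q" unfolding Q_def using u by (intro sum_nonneg mult_nonneg_nonneg) (auto intro: less_imp_le)
  with False have Q: "0 < Q" by simp
  have v: "v = Q - m\<^sup>2"
  proof -
    have "v = (\<Sum>i\<in>I. u i * (g i)\<^sup>2 - 2 * m * (u i * g i) + m\<^sup>2 * u i)"
      unfolding v_def m_def[symmetric] by (intro sum.cong refl) (simp add: power2_eq_square algebra_simps)
    also have "\<dots> = Q - 2 * m * m + m\<^sup>2 * 1"
      unfolding Q_def m_def u(2)[symmetric] by (simp add: sum.distrib sum_subtractf sum_distrib_left)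
    finally show ?thesis by (simp add: power2_eq_square)
  qed
  have v0: "0 \<le> v" unfolding v_def using u by (intro sum_nonneg mult_nonneg_nonneg) (auto intro: less_imp_le)
  let ?h = "\<lambda>i. (g i)\<^sup>2"
  have "(\<Sum>i\<in>I. u i * (?h i * ln (?h i))) \<le> (\<Sum>i\<in>I. u i * (?h i * ln Q + ?h i * (?h i / Q - 1)))"
  proof (intro sum_mono mult_left_mono)
    fix i assume i: "i \<in> I"
    show "?h i * ln (?h i) \<le> ?h i * ln Q + ?h i * (?h i / Q - 1)"
    proof (cases "g i = 0")
      case False
      then have h: "0 < ?h i" by simp
      have "ln (?h i / Q) \<le> ?h i / Q - 1" using h Q by (intro ln_le_minus_one) simp
      then have "ln (?h i) \<le> ln Q + (?h i / Q - 1)" using h Q by (subst (asm) ln_div) (simp_all)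
      then show ?thesis using h by (simp flip: distrib_left)
    qed simp
  qed (use u in \<open>auto intro: less_imp_le\<close>)
  also have "\<dots> = (\<Sum>i\<in>I. u i * ?h i) * ln Q + ((\<Sum>i\<in>I. u i * (?h i)\<^sup>2) / Q - (\<Sum>i\<in>I. u i * ?h i))"
    by (simp add: algebra_simps power2_eq_square sum.distrib sum_subtractf sum_distrib_left sum_divide_distrib)
  also have "\<dots> = Q * ln Q + ((\<Sum>i\<in>I. u i * (?h i)\<^sup>2) / Q - Q)" by (simp add: Q_def)
  finally have 1: "(\<Sum>i\<in>I. u i * (?h i * ln (?h i))) - Q * ln Q \<le> ((\<Sum>i\<in>I. u i * (?h i)\<^sup>2) - Q\<^sup>2) / Q"
    using Q by (simp add: diff_divide_distrib power2_eq_square)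
  \<comment> \<open>The added square moves the centre from \<open>Q\<close> to
    \<open>m\<^sup>2\<close>, so that the deviation factors as
    \<open>(g i - m) * (g i + m)\<close>.\<close>
  have "(\<Sum>i\<in>I. u i * (?h i)\<^sup>2) - Q\<^sup>2 \<le> (\<Sum>i\<in>I. u i * (?h i)\<^sup>2) - Q\<^sup>2 + (Q - m\<^sup>2)\<^sup>2" by simp
  also have "\<dots> = (\<Sum>i\<in>I. u i * (?h i)\<^sup>2) - 2 * m\<^sup>2 * (\<Sum>i\<in>I. u i * ?h i) + (m\<^sup>2)\<^sup>2 * (\<Sum>i\<in>I. u i)"
    unfolding u Q_def[symmetric] by (simp add: power2_eq_square algebra_simps)
  also have "\<dots> = (\<Sum>i\<in>I. u i * (?h i - m\<^sup>2)\<^sup>2)"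
    by (simp add: sum_distrib_left flip: sum.distrib sum_subtractf)
       (intro sum.cong refl, simp add: power2_eq_square power4_eq_xxxx algebra_simps)
  also have "\<dots> \<le> (\<Sum>i\<in>I. u i * (v / l * (g i + m)\<^sup>2))"
  proof (intro sum_mono mult_left_mono)
    fix i assume i: "i \<in> I"
    have "(?h i - m\<^sup>2)\<^sup>2 = (g i - m)\<^sup>2 * (g i + m)\<^sup>2"
      by (simp add: power2_eq_square algebra_simps)
    also have "\<dots> \<le> v / l * (g i + m)\<^sup>2"
      using g[OF i] l by (intro mult_right_mono) (simp_all add: field_simps)
    finally show "(?h i - m\<^sup>2)\<^sup>2 \<le> v / l * (g i + m)\<^sup>2" .
  qed (use u in \<open>auto intro: less_imp_le\<close>)
  also have "\<dots> = v / l * (\<Sum>i\<in>I. u i * (g i + m)\<^sup>2)"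
    by (simp add: sum_distrib_left mult.left_commute)
  also have "(\<Sum>i\<in>I. u i * (g i + m)\<^sup>2) = (\<Sum>i\<in>I. u i * (g i)\<^sup>2 + 2 * m * (u i * g i) + m\<^sup>2 * u i)"
    by (intro sum.cong refl) (simp add: power2_eq_square algebra_simps)
  also have "\<dots> = Q + 2 * m * m + m\<^sup>2 * 1"
    unfolding Q_def m_def u(2)[symmetric] by (simp add: sum.distrib sum_distrib_left)
  also have "v / l * \<dots> \<le> v / l * (4 * Q)"
    using v0 v l by (intro mult_left_mono) (simp_all add: power2_eq_square)
  finally have "((\<Sum>i\<in>I. u i * (?h i)\<^sup>2) - Q\<^sup>2) / Q \<le> 4 / l * v"
    using Q by (simp add: divide_le_eq mult.commute mult.left_commute)
  with 1 show ?thesis by simp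
qed

section \<open>Averaging operators on powers of a finite path\<close>

locale block_path =
  fixes n R :: nat and p :: "nat \<Rightarrow> real"
  assumes R_pos: "0 < R"
    and p_pos: "i < n \<Longrightarrow> 0 < p i"
    and p_sum: "(\<Sum>i<n. p i) = 1"
begin

definition L :: nat where "L = n * R"

definition w :: "nat \<Rightarrow> real" where "w a = p (a div R) / R"

lemma div_less_n: "a < L \<Longrightarrow> a div R < n"
  by (simp add: L_def less_mult_imp_div_less)

lemma w_pos: "a < L \<Longrightarrow> 0 < w a"
  using div_less_n[of a] p_pos R_pos by (simp add: w_def)

lemma w_nonneg: "a < L \<Longrightarrow> 0 \<le> w a"
  using w_pos by (simp add: less_imp_le)

lemma sum_blocks: "(\<Sum>a<L. f a) = (\<Sum>i<n. \<Sum>a=i*R..<i*R+R. f a)" for f :: "nat \<Rightarrow> real"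
  by (simp add: L_def sum.nat_group)

lemma in_block_iff: "a \<in> {i*R..<i*R+R} \<longleftrightarrow> a div R = i"
proof
  assume "a \<in> {i*R..<i*R+R}"
  then show "a div R = i" by (intro div_nat_eqI) (auto simp: mult.commute)
next
  assume "a div R = i"
  moreover have "a = a div R * R + a mod R" by simp
  moreover have "a mod R < R" using R_pos by simp
  ultimately show "a \<in> {i*R..<i*R+R}" by auto
qed

lemma sum_w_block: "(\<Sum>a=i*R..<i*R+R. w a) = p i"
proof -
  have "(\<Sum>a=i*R..<i*R+R. w a) = (\<Sum>a=i*R..<i*R+R. p i / R)"
    by (intro sum.cong refl) (simp add: w_def in_block_iff del: atLeastLessThan_iff)
  then show ?thesis using R_pos by simp
qed

lemma w_sum: "(\<Sum>a<L. w a) = 1"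
  unfolding sum_blocks sum_w_block p_sum ..

lemma L_pos: "0 < L"
  using w_sum by (cases "L = 0") auto

text \<open>The conditional expectation given all coordinates but \<open>j\<close>, kept as a
  function on the same space so that these operators compose and commute.\<close>

definition av :: "nat \<Rightarrow> ((nat \<Rightarrow> nat) \<Rightarrow> real) \<Rightarrow> (nat \<Rightarrow> nat) \<Rightarrow> real" where
  "av j f x = (\<Sum>a<L. w a * f (x(j := a)))"

fun avl :: "nat list \<Rightarrow> ((nat \<Rightarrow> nat) \<Rightarrow> real) \<Rightarrow> (nat \<Rightarrow> nat) \<Rightarrow> real" where
  "avl [] f = f"
| "avl (j # js) f = av j (avl js f)"

lemma av_add: "av j (\<lambda>x. f x + g x) = (\<lambda>x. av j f x + av j g x)"
  by (rule ext) (simp add: av_def distrib_left sum.distrib)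

lemma av_diff: "av j (\<lambda>x. f x - g x) = (\<lambda>x. av j f x - av j g x)"
  by (rule ext) (simp add: av_def right_diff_distrib sum_subtractf)

lemma av_cmult: "av j (\<lambda>x. c * f x) = (\<lambda>x. c * av j f x)"
  by (rule ext) (simp add: av_def sum_distrib_left mult.left_commute)

lemma av_const: "av j (\<lambda>x. c) = (\<lambda>x. c)"
  by (rule ext) (simp add: av_def w_sum flip: sum_distrib_right)

lemma av_mono:
  assumes "\<And>a. a < L \<Longrightarrow> f (x(j := a)) \<le> g (x(j := a))"
  shows "av j f x \<le> av j g x"
  unfolding av_def by (intro sum_mono mult_left_mono) (use assms w_nonneg in auto)

lemma av_upd: "av j f (x(j := a)) = av j f x"
  by (simp add: av_def)

lemma av_commute: "av i (av j f) = av j (av i f)"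
proof (cases "i = j")
  case False
  show ?thesis
  proof
    fix x
    have "av i (av j f) x = (\<Sum>a<L. \<Sum>b<L. w a * (w b * f (x(i := a, j := b))))"
      by (simp add: av_def sum_distrib_left)
    also have "\<dots> = (\<Sum>b<L. \<Sum>a<L. w a * (w b * f (x(i := a, j := b))))"
      by (rule sum.swap)
    also have "\<dots> = av j (av i f) x"
      unfolding fun_upd_twist[OF False] by (simp add: av_def sum_distrib_left mult.left_commute)
    finally show "av i (av j f) x = av j (av i f) x" .
  qed
qed simp

lemma av_pull:
  assumes "\<And>x a. g (x(j := a)) = g x"
  shows "av j (\<lambda>x. f x * g x) = (\<lambda>x. av j f x * g x)"
  by (rule ext) (simp add: av_def assms sum_distrib_right mult.assoc)

lemma av_inv:
  assumes "\<And>x a. g (x(j := a)) = g x"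
  shows "av j g = g"
  by (rule ext) (simp add: av_def assms w_sum flip: sum_distrib_right)

lemma av_idem: "av j (av j f) = av j f"
  by (rule av_inv) (rule av_upd)

lemma avl_add: "avl js (\<lambda>x. f x + g x) = (\<lambda>x. avl js f x + avl js g x)"
  by (induction js) (simp_all add: av_add)

lemma avl_diff: "avl js (\<lambda>x. f x - g x) = (\<lambda>x. avl js f x - avl js g x)"
  by (induction js) (simp_all add: av_diff)

lemma avl_cmult: "avl js (\<lambda>x. c * f x) = (\<lambda>x. c * avl js f x)"
  by (induction js) (simp_all add: av_cmult)

lemma avl_const: "avl js (\<lambda>x. c) = (\<lambda>x. c)"
  by (induction js) (simp_all add: av_const)

lemma avl_mono:
  assumes "\<And>y. (\<And>k. k \<in> set js \<Longrightarrow> y k < L) \<Longrightarrow> (\<And>k. k \<notin> set js \<Longrightarrow> y k = x k) \<Longrightarrow> f y \<le> g y"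
  shows "avl js f x \<le> avl js g x"
  using assms
proof (induction js arbitrary: x)
  case (Cons j js)
  have "avl js f (x(j := a)) \<le> avl js g (x(j := a))" if "a < L" for a
  proof (rule Cons.IH)
    fix y assume y: "\<And>k. k \<in> set js \<Longrightarrow> y k < L" "\<And>k. k \<notin> set js \<Longrightarrow> y k = (x(j := a)) k"
    show "f y \<le> g y"
      by (rule Cons.prems) (use y that in \<open>auto split: if_splits\<close>, metis)
  qed
  then show ?case by (auto intro: av_mono)
qed auto

lemma avl_av_commute: "avl js (av i f) = av i (avl js f)"
  by (induction js) (simp_all add: av_commute)

lemma avl_absorb: "j \<in> set js \<Longrightarrow> avl js (av j f) = avl js f"
proof (induction js)
  case (Cons i js)
  show ?case
  proof (cases "i = j")
    case True
    then show ?thesis by (simp add: avl_av_commute av_idem)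
  next
    case False
    then show ?thesis using Cons by simp
  qed
qed simp

lemma avl_absorb_list: "set ts \<subseteq> set js \<Longrightarrow> avl js (avl ts f) = avl js f"
  by (induction ts) (simp_all add: avl_absorb)

lemma avl_upd: "j \<in> set js \<Longrightarrow> avl js f (x(j := a)) = avl js f x"
proof (induction js arbitrary: x)
  case (Cons i js)
  show ?case
  proof (cases "i = j")
    case False
    then have j: "j \<in> set js" using Cons.prems by simp
    have "avl js f (x(j := a, i := b)) = avl js f (x(i := b))" for b
    proof -
      have "x(j := a, i := b) = x(i := b, j := a)"
        by (rule fun_upd_twist) (use False in simp)
      then show ?thesis by (simp only: Cons.IH[OF j])
    qed
    then show ?thesis by (simp only: av_def avl.simps)
  qed (simp only: avl.simps av_upd)
qed simp

lemma avl_cong_outside: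
  assumes "\<And>k. k \<notin> set js \<Longrightarrow> x k = y k"
  shows "avl js f x = avl js f y"
  using assms
proof (induction js arbitrary: x y)
  case Nil
  then have "x = y" by auto
  then show ?case by simp
next
  case (Cons j js)
  have "avl js f (x(j := a)) = avl js f (y(j := a))" for a
    by (rule Cons.IH) (use Cons.prems in auto)
  then show ?case by (simp add: av_def)
qed

lemma avl_pull:
  assumes "\<And>x j a. j \<in> set js \<Longrightarrow> g (x(j := a)) = g x"
  shows "avl js (\<lambda>x. f x * g x) = (\<lambda>x. avl js f x * g x)"
  using assms by (induction js) (simp_all add: av_pull)

lemma avl_abs: "\<bar>avl js f x\<bar> \<le> avl js (\<lambda>x. \<bar>f x\<bar>) x"
proof (rule abs_leI)
  show "avl js f x \<le> avl js (\<lambda>x. \<bar>f x\<bar>) x" by (rule avl_mono) simp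
  have "avl js (\<lambda>x. (-1) * f x) x \<le> avl js (\<lambda>x. \<bar>f x\<bar>) x" by (rule avl_mono) simp
  then show "- avl js f x \<le> avl js (\<lambda>x. \<bar>f x\<bar>) x" unfolding avl_cmult by simp
qed

lemma avl_nonneg: "(\<And>x. 0 \<le> f x) \<Longrightarrow> 0 \<le> avl js f x"
  using avl_mono[of js x "\<lambda>_. 0" f] by (simp add: avl_const)

text \<open>Turns the iterated average into one expectation under product weights. This form is
  compared with the product measure in \<open>measure_le_avl\<close>, and in
  \<open>cylinder_dist\<close> it allows one completion to be picked for two averages.\<close>

lemma avl_eq_sum:
  assumes "distinct js"
  shows "avl js f x = (\<Sum>z\<in>PiE (set js) (\<lambda>_. {..<L}). (\<Prod>k\<in>set js. w (z k)) *
           f (\<lambda>k. if k \<in> set js then z k else x k))"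
  using assms
proof (induction js arbitrary: x)
  case (Cons j js)
  let ?P = "PiE (set js) (\<lambda>_. {..<L})"
  have j: "j \<notin> set js" using Cons.prems by simp
  have "avl (j # js) f x = (\<Sum>a<L. \<Sum>z\<in>?P. w a * ((\<Prod>k\<in>set js. w (z k)) *
           f (\<lambda>k. if k \<in> set js then z k else (x(j := a)) k)))"
    using Cons by (simp add: av_def sum_distrib_left)
  also have "\<dots> = (\<Sum>(a, z)\<in>{..<L} \<times> ?P. w a * ((\<Prod>k\<in>set js. w (z k)) *
           f (\<lambda>k. if k \<in> set js then z k else (x(j := a)) k)))"
    by (rule sum.cartesian_product)
  also have "\<dots> = (\<Sum>z\<in>PiE (set (j # js)) (\<lambda>_. {..<L}). (\<Prod>k\<in>set (j # js). w (z k)) *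
           f (\<lambda>k. if k \<in> set (j # js) then z k else x k))"
    unfolding list.set PiE_insert_eq
  proof (subst sum.reindex)
    show "inj_on (\<lambda>(y, g). g(j := y)) ({..<L} \<times> ?P)"
      using inj_combinator[OF j, of "\<lambda>_. {..<L}"] .
    let ?F = "\<lambda>z. (\<Prod>k\<in>insert j (set js). w (z k)) *
             f (\<lambda>k. if k \<in> insert j (set js) then z k else x k)"
    have "w a * ((\<Prod>k\<in>set js. w (z k)) * f (\<lambda>k. if k \<in> set js then z k else (x(j := a)) k))
      = ?F (z(j := a))" for a z
    proof -
      have "(\<Prod>k\<in>insert j (set js). w ((z(j := a)) k)) = w a * (\<Prod>k\<in>set js. w (z k))"
        using j by (subst prod.insert) (auto intro!: prod.cong)
      moreover have "(\<lambda>k. if k \<in> set js then z k else (x(j := a)) k) =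
         (\<lambda>k. if k \<in> insert j (set js) then (z(j := a)) k else x k)"
        using j by auto
      ultimately show ?thesis by (simp only: mult.assoc)
    qed
    then show "(\<Sum>(a, z)\<in>{..<L} \<times> ?P. w a * ((\<Prod>k\<in>set js. w (z k)) *
             f (\<lambda>k. if k \<in> set js then z k else (x(j := a)) k)))
        = sum (?F \<circ> (\<lambda>(y, g). g(j := y))) ({..<L} \<times> ?P)"
      by (intro sum.cong refl) (auto simp only: o_def split: prod.split)
  qed
  finally show ?case .
qed simp

section \<open>Entropy on products\<close>

definition xlnx :: "((nat \<Rightarrow> nat) \<Rightarrow> real) \<Rightarrow> (nat \<Rightarrow> nat) \<Rightarrow> real" where
  "xlnx h x = h x * ln (h x)"

definition ent :: "nat \<Rightarrow> ((nat \<Rightarrow> nat) \<Rightarrow> real) \<Rightarrow> (nat \<Rightarrow> nat) \<Rightarrow> real" where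
  "ent j h x = av j (xlnx h) x - xlnx (av j h) x"

text \<open>Puts the entropy into the shape of the right-hand side of \<open>log_sum_ineq\<close>,
  with \<open>av j h\<close> in the role of \<open>b\<close>.\<close>

lemma ent_eq: "ent j h = av j (\<lambda>x. h x * ln (h x) - h x * ln (av j h x))"
proof -
  have "av j (\<lambda>x. h x * ln (av j h x)) = (\<lambda>x. av j h x * ln (av j h x))"
    by (rule av_pull) (simp add: av_upd)
  moreover have "av j (xlnx h) = av j (\<lambda>x. h x * ln (h x))"
    by (intro arg_cong[of _ _ "av j"] ext xlnx_def)
  ultimately show ?thesis
    unfolding av_diff by (simp add: ent_def xlnx_def[of "av j h"] fun_eq_iff)
qed

lemma ent_upd: "ent j h (x(j := a)) = ent j h x"
  unfolding ent_eq by (rule av_upd)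

lemma av_nonneg: "(\<And>x. 0 \<le> f x) \<Longrightarrow> 0 \<le> av j f x"
  using av_mono[of "\<lambda>_. 0" x j f] by (simp add: av_const)

lemma av_eq_0D:
  assumes "\<And>x. 0 \<le> h x" "av k h x = 0" "x k < L"
  shows "h x = 0"
  using weighted_sum_eq_0D[of "{..<L}" w "\<lambda>a. h (x(k := a))" "x k"] assms w_pos
  by (simp add: av_def)

text \<open>Relative entropy is jointly convex: at each value of coordinate \<open>k\<close>,
  \<open>log_sum_ineq\<close> is applied over the values of coordinate \<open>i\<close> to the two
  families given by \<open>h\<close> and \<open>av k h\<close>.\<close>

lemma ent_av_le:
  assumes h: "\<And>x. 0 \<le> h x"
  shows "ent k (av i h) x \<le> av i (ent k h) x"
proof -
  let ?b = "av k h"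
  have "ent k (av i h) x = av k (\<lambda>x. av i h x * ln (av i h x) - av i h x * ln (av i ?b x)) x"
    unfolding ent_eq by (simp add: av_commute)
  also have "\<dots> \<le> av k (av i (\<lambda>x. h x * ln (h x) - h x * ln (?b x))) x"
  proof (rule av_mono)
    fix a assume a: "a < L"
    define y where "y = x(k := a)"
    have "av i h y * ln (av i h y) - av i h y * ln (av i ?b y)
       \<le> (\<Sum>c<L. w c * (h (y(i := c)) * ln (h (y(i := c))) - h (y(i := c)) * ln (?b (y(i := c)))))"
      unfolding av_def[of i]
    proof (rule log_sum_ineq)
      \<comment> \<open>A vanishing average forces \<open>h\<close> to vanish only at sites below
        \<open>L\<close>; hence \<open>a\<close> and \<open>c\<close> are kept below
        \<open>L\<close>.\<close>
      fix c assume c: "c \<in> {..<L}" and 0: "?b (y(i := c)) = 0"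
      show "h (y(i := c)) = 0"
        using h 0 by (rule av_eq_0D) (use a c in \<open>simp add: y_def\<close>)
    qed (use h w_pos av_nonneg in auto)
    then show "av i h y * ln (av i h y) - av i h y * ln (av i ?b y)
       \<le> av i (\<lambda>x. h x * ln (h x) - h x * ln (?b x)) y"
      by (simp add: av_def[of i "\<lambda>x. h x * ln (h x) - h x * ln (?b x)"])
  qed
  also have "\<dots> = av i (ent k h) x"
    unfolding ent_eq by (subst av_commute) simp
  finally show ?thesis .
qed

lemma ent_avl_le:
  assumes h: "\<And>x. 0 \<le> h x"
  shows "ent k (avl js h) x \<le> avl js (ent k h) x"
proof (induction js arbitrary: x)
  case (Cons j js)
  have "ent k (av j (avl js h)) x \<le> av j (ent k (avl js h)) x"
    by (rule ent_av_le) (rule avl_nonneg[OF h])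
  also have "\<dots> \<le> av j (avl js (ent k h)) x"
    by (rule av_mono) (rule Cons.IH)
  finally show ?case by simp
qed simp

text \<open>Chain rule: integrating out one more coordinate \<open>j\<close> splits off the entropy
  in \<open>j\<close> of the partial average, which \<open>ent_avl_le\<close> bounds by the mean of
  \<open>ent j h\<close>.\<close>

lemma ent_tensor:
  assumes h: "\<And>x. 0 \<le> h x"
  shows "avl js (xlnx h) x - xlnx (avl js h) x \<le> (\<Sum>j\<leftarrow>js. avl js (ent j h) x)"
proof (induction js arbitrary: x)
  case (Cons j js)
  have "avl (j # js) (xlnx h) x - xlnx (avl (j # js) h) x =
    av j (\<lambda>x. avl js (xlnx h) x - xlnx (avl js h) x) x + ent j (avl js h) x"
    by (simp add: ent_def av_diff)
  also have "\<dots> \<le> av j (\<lambda>x. \<Sum>i\<leftarrow>js. avl js (ent i h) x) x + avl js (ent j h) x"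
    by (intro add_mono av_mono Cons.IH ent_avl_le h)
  also have "av j (\<lambda>x. \<Sum>i\<leftarrow>js. avl js (ent i h) x) x = (\<Sum>i\<leftarrow>js. avl (j # js) (ent i h) x)"
  proof -
    have "av j (\<lambda>x. \<Sum>i\<leftarrow>is. avl js (ent i h) x) x = (\<Sum>i\<leftarrow>is. avl (j # js) (ent i h) x)" for "is"
      by (induction "is") (simp_all add: av_add av_const)
    then show ?thesis .
  qed
  \<comment> \<open>The extra average is harmless because \<open>ent j h\<close> is constant in
    coordinate \<open>j\<close>.\<close>
  also have "avl js (ent j h) x = avl (j # js) (ent j h) x"
  proof -
    have "av j (ent j h) = ent j h" by (rule av_inv) (rule ent_upd)
    then have "av j (avl js (ent j h)) = avl js (ent j h)"
      using avl_av_commute[of js j "ent j h"] by simp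
    then show ?thesis by simp
  qed
  finally show ?case by (simp add: add.commute)
qed (simp add: xlnx_def)

definition block_const :: "nat \<Rightarrow> ((nat \<Rightarrow> nat) \<Rightarrow> real) \<Rightarrow> bool" where
  "block_const j f \<longleftrightarrow> (\<forall>x a b. a div R = b div R \<longrightarrow> f (x(j := a)) = f (x(j := b)))"

text \<open>A single site has mass only \<open>p i / R\<close>, but \<open>f\<close> is constant on
  its whole block, of mass at least \<open>l\<close>. This block alone contributes at least
  \<open>l * (?g a - ?m)\<^sup>2\<close> to the variance, so the constant does not involve
  \<open>R\<close>.\<close>

lemma ent_square_le:
  assumes f: "block_const j f" and l: "0 < l" "\<And>i. i < n \<Longrightarrow> l \<le> p i"
  shows "ent j (\<lambda>x. (f x)\<^sup>2) x \<le> 4 / l * av j (\<lambda>x. (f x - av j f x)\<^sup>2) x"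
proof -
  let ?g = "\<lambda>a. f (x(j := a))"
  let ?m = "\<Sum>a<L. w a * ?g a"
  let ?v = "\<Sum>a<L. w a * (?g a - ?m)\<^sup>2"
  have "l * (?g a - ?m)\<^sup>2 \<le> ?v" if a: "a < L" for a
  proof -
    let ?B = "{a div R * R..<a div R * R + R}"
    have n: "a div R < n" using a by (rule div_less_n)
    have "a div R * R + R \<le> n * R"
      using n by (metis Suc_leI add.commute mult_Suc mult_le_mono1)
    then have B: "?B \<subseteq> {..<L}" by (auto simp: L_def)
    have "l * (?g a - ?m)\<^sup>2 \<le> p (a div R) * (?g a - ?m)\<^sup>2"
      using l n by (intro mult_right_mono) auto
    also have "\<dots> = (\<Sum>b\<in>?B. w b * (?g a - ?m)\<^sup>2)"
      by (simp add: sum_w_block flip: sum_distrib_right)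
    also have "\<dots> = (\<Sum>b\<in>?B. w b * (?g b - ?m)\<^sup>2)"
    proof (intro sum.cong refl)
      fix b assume "b \<in> ?B"
      then have "b div R = a div R" unfolding in_block_iff .
      then have "?g b = ?g a" using f unfolding block_const_def by blast
      then show "w b * (?g a - ?m)\<^sup>2 = w b * (?g b - ?m)\<^sup>2" by simp
    qed
    also have "\<dots> \<le> ?v"
      using B w_nonneg by (intro sum_mono2) auto
    finally show ?thesis .
  qed
  then have "(\<Sum>a<L. w a * ((?g a)\<^sup>2 * ln ((?g a)\<^sup>2))) - (\<Sum>a<L. w a * (?g a)\<^sup>2) * ln (\<Sum>a<L. w a * (?g a)\<^sup>2)
     \<le> 4 / l * ?v"
    by (intro log_sobolev_one_site) (use w_pos w_sum l in auto)
  then show ?thesis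
    by (simp add: ent_def xlnx_def av_def)
qed

text \<open>If the first term does not suffice, then \<open>ln Z \<le> ln (?A / ?B\<^sup>2)\<close>,
  while the entropy of \<open>f\<^sup>2\<close> is at least
  \<open>?A * ln (?A / ?B\<^sup>2)\<close>. Tensorisation and \<open>ent_square_le\<close> bound
  this entropy by the energy.\<close>

lemma super_poincare:
  assumes f: "\<And>j. j \<in> set js \<Longrightarrow> block_const j f" and l: "0 < l" "\<And>i. i < n \<Longrightarrow> l \<le> p i"
    and f1: "\<And>x. \<bar>f x\<bar> \<le> 1" and Z: "1 < Z"
  shows "avl js (\<lambda>x. (f x)\<^sup>2) x \<le> Z * (avl js (\<lambda>x. \<bar>f x\<bar>) x)\<^sup>2
     + 4 / (l * ln Z) * (\<Sum>j\<leftarrow>js. avl js (\<lambda>x. (f x - av j f x)\<^sup>2) x)"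
proof -
  let ?A = "avl js (\<lambda>x. (f x)\<^sup>2) x" and ?B = "avl js (\<lambda>x. \<bar>f x\<bar>) x"
  let ?E = "\<Sum>j\<leftarrow>js. avl js (\<lambda>x. (f x - av j f x)\<^sup>2) x"
  have lnZ: "0 < ln Z" using Z by simp
  have E0: "0 \<le> ?E" by (intro sum_list_nonneg) (auto intro: avl_nonneg)
  have sq: "(f x)\<^sup>2 \<le> \<bar>f x\<bar>" for x
    using f1[of x] mult_left_le[of "\<bar>f x\<bar>" "\<bar>f x\<bar>"] by (simp add: power2_eq_square abs_mult_self_eq)
  have AB: "?A \<le> ?B" by (rule avl_mono) (rule sq)
  show ?thesis
  proof (cases "?A \<le> Z * ?B\<^sup>2")
    case True
    then show ?thesis using E0 l lnZ
      by (intro order_trans[OF True]) (simp add: mult_nonneg_nonneg)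
  next
    case False
    have A: "0 < ?A"
    proof -
      have "0 \<le> Z * ?B\<^sup>2" using Z by simp
      then show ?thesis using False by linarith
    qed
    then have B: "0 < ?B" using AB by linarith
    have "ln Z * ?A \<le> (ln ?A - 2 * ln ?B) * ?A"
    proof (rule mult_right_mono)
      have "Z \<le> ?A / ?B\<^sup>2" using False B by (simp add: le_divide_eq)
      then have "ln Z \<le> ln (?A / ?B\<^sup>2)" using Z B by (subst ln_le_cancel_iff) (auto intro: less_le_trans)
      also have "\<dots> = ln ?A - 2 * ln ?B" using A B by (simp add: ln_div ln_realpow)
      finally show "ln Z \<le> ln ?A - 2 * ln ?B" .
    qed (use A in simp)
    also have "\<dots> \<le> avl js (xlnx (\<lambda>x. (f x)\<^sup>2)) x - xlnx (avl js (\<lambda>x. (f x)\<^sup>2)) x"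
    proof -
      \<comment> \<open>This is \<open>log_sum_pointwise\<close> for \<open>f\<^sup>2\<close>
        against \<open>\<bar>f\<bar>\<close>. The logarithm of their ratio is half of
        \<open>ln (f\<^sup>2)\<close>, whence the factor \<open>1/2\<close>; the linear terms
        average to \<open>?A - (?A / ?B) * ?B = 0\<close>.\<close>
      have "avl js (\<lambda>x. ln (?A / ?B) * (f x)\<^sup>2 + (f x)\<^sup>2 - (?A / ?B) * \<bar>f x\<bar>) x
         \<le> avl js (\<lambda>x. (1/2) * xlnx (\<lambda>x. (f x)\<^sup>2) x) x"
      proof (rule avl_mono)
        fix y
        have "(f y)\<^sup>2 * ln (?A / ?B) + (f y)\<^sup>2 - \<bar>f y\<bar> * (?A / ?B) \<le> (f y)\<^sup>2 * ln ((f y)\<^sup>2) - (f y)\<^sup>2 * ln \<bar>f y\<bar>"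
          using A B by (intro log_sum_pointwise) auto
        also have "\<dots> = (1/2) * xlnx (\<lambda>x. (f x)\<^sup>2) y"
        proof (cases "f y = 0")
          case False
          then have "ln ((f y)\<^sup>2) = 2 * ln \<bar>f y\<bar>"
            using ln_realpow[of "\<bar>f y\<bar>" 2] by simp
          then show ?thesis by (simp add: xlnx_def)
        qed (simp add: xlnx_def)
        finally show "ln (?A / ?B) * (f y)\<^sup>2 + (f y)\<^sup>2 - (?A / ?B) * \<bar>f y\<bar> \<le> (1/2) * xlnx (\<lambda>x. (f x)\<^sup>2) y"
          by (simp add: mult.commute)
      qed
      then have "ln (?A / ?B) * ?A + ?A - (?A / ?B) * ?B \<le> (1/2) * avl js (xlnx (\<lambda>x. (f x)\<^sup>2)) x"
        unfolding avl_diff avl_add avl_cmult .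
      then have "2 * (ln (?A / ?B) * ?A) \<le> avl js (xlnx (\<lambda>x. (f x)\<^sup>2)) x"
        using B by simp
      moreover have "ln (?A / ?B) = ln ?A - ln ?B" using A B by (simp add: ln_div)
      ultimately show ?thesis by (simp add: xlnx_def[of "avl js _"] algebra_simps)
    qed
    also have "\<dots> \<le> (\<Sum>j\<leftarrow>js. avl js (ent j (\<lambda>x. (f x)\<^sup>2)) x)"
      by (rule ent_tensor) simp
    also have "\<dots> \<le> (\<Sum>j\<leftarrow>js. 4 / l * avl js (\<lambda>x. (f x - av j f x)\<^sup>2) x)"
    proof (rule sum_list_mono)
      fix j assume j: "j \<in> set js"
      have "avl js (ent j (\<lambda>x. (f x)\<^sup>2)) x \<le> avl js (\<lambda>x. 4 / l * av j (\<lambda>x. (f x - av j f x)\<^sup>2) x) x"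
        by (intro avl_mono ent_square_le f j l)
      also have "\<dots> = 4 / l * avl js (\<lambda>x. (f x - av j f x)\<^sup>2) x"
        unfolding avl_cmult using avl_absorb[OF j] by simp
      finally show "avl js (ent j (\<lambda>x. (f x)\<^sup>2)) x \<le> 4 / l * avl js (\<lambda>x. (f x - av j f x)\<^sup>2) x" .
    qed
    also have "\<dots> = 4 / l * ?E" by (rule sum_list_const_mult)
    finally have "?A \<le> 4 / (l * ln Z) * ?E"
      using lnZ l by (simp add: field_simps)
    moreover have "0 \<le> Z * ?B\<^sup>2" using Z by simp
    ultimately show ?thesis by linarith
  qed
qed

section \<open>Oscillation and block averages\<close>

definition osc :: "nat \<Rightarrow> ((nat \<Rightarrow> nat) \<Rightarrow> real) \<Rightarrow> (nat \<Rightarrow> nat) \<Rightarrow> real" where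
  "osc j f x = Max ((\<lambda>(a, b). f (x(j := a)) - f (x(j := b))) ` ({..<L} \<times> {..<L}))"

lemma osc_ge: "a < L \<Longrightarrow> b < L \<Longrightarrow> f (x(j := a)) - f (x(j := b)) \<le> osc j f x"
  unfolding osc_def by (rule Max_ge) auto

lemma osc_attained:
  obtains a b where "a < L" "b < L" "osc j f x = f (x(j := a)) - f (x(j := b))"
proof -
  have "osc j f x \<in> (\<lambda>(a, b). f (x(j := a)) - f (x(j := b))) ` ({..<L} \<times> {..<L})"
    unfolding osc_def using L_pos by (intro Max_in) auto
  then show thesis using that by auto
qed

lemma osc_leI:
  assumes "\<And>a b. a < L \<Longrightarrow> b < L \<Longrightarrow> f (x(j := a)) - f (x(j := b)) \<le> c"
  shows "osc j f x \<le> c"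
  using osc_attained[of j f x] assms by metis

lemma osc_upd: "osc j f (x(j := a)) = osc j f x"
  by (simp add: osc_def)

lemma osc_nonneg: "0 \<le> osc j f x"
  using osc_ge[of 0 0 f x j] L_pos by simp

section \<open>Dilations and the total mean oscillation\<close>

definition dil :: "nat \<Rightarrow> ((nat \<Rightarrow> nat) \<Rightarrow> real) \<Rightarrow> (nat \<Rightarrow> nat) \<Rightarrow> real" where
  "dil j f x = Max (insert (f x) ((\<lambda>b. f (x(j := b))) ` {b. b < L \<and> b \<le> x j + 1 \<and> x j \<le> b + 1}))"

text \<open>Holds for \<open>x j \<ge> L\<close> as well, because \<open>f x\<close> is inserted
  into the maximum.\<close>

lemma le_dil: "f x \<le> dil j f x"
  unfolding dil_def by (rule Max_ge) auto

lemma le_dil_nbr: "b < L \<Longrightarrow> b \<le> x j + 1 \<Longrightarrow> x j \<le> b + 1 \<Longrightarrow> f (x(j := b)) \<le> dil j f x"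
  unfolding dil_def by (rule Max_ge) auto

lemma dil_leI:
  assumes "f x \<le> c" "\<And>b. b \<le> x j + 1 \<Longrightarrow> x j \<le> b + 1 \<Longrightarrow> f (x(j := b)) \<le> c"
  shows "dil j f x \<le> c"
  unfolding dil_def using assms by (subst Max_le_iff) auto

text \<open>A walk from the minimum to the maximum of \<open>f\<close> along the line collects the whole oscillation.\<close>

lemma dil_gain:
  assumes u: "0 \<le> u" "\<And>a. a < L \<Longrightarrow> u \<le> w a"
  shows "u * osc j f x \<le> av j (dil j f) x - av j f x"
proof -
  define g where "g c = f (x(j := c))" for c
  define h where "h c = dil j f (x(j := c)) - g c" for c
  have h0: "0 \<le> h c" for c
    using le_dil[of f "x(j := c)" j] by (simp add: h_def g_def)
  have step: "g b - g c \<le> h c" if "b < L" "b \<le> c + 1" "c \<le> b + 1" for b c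
    using le_dil_nbr[of b "x(j := c)" j f] that by (simp add: h_def g_def)
  obtain a b where ab: "a < L" "b < L" "osc j f x = g a - g b"
    unfolding g_def by (rule osc_attained)
  have "g a - g b \<le> (\<Sum>c<L. h c)"
  proof (cases "b \<le> a")
    case True
    have "g a - g b = (\<Sum>c=b..<a. g (Suc c) - g c)"
      using True by (simp add: sum_Suc_diff')
    also have "\<dots> \<le> (\<Sum>c=b..<a. h c)"
      by (intro sum_mono step) (use ab in auto)
    also have "\<dots> \<le> (\<Sum>c<L. h c)"
      by (intro sum_mono2) (use ab h0 in auto)
    finally show ?thesis .
  next
    case False
    have "g a - g b = (\<Sum>c=a..<b. g c - g (Suc c))"
      using False sum_Suc_diff'[of a b g] by (simp add: sum_subtractf)
    \<comment> \<open>The walk now descends, so each increase is charged to its starting site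
      \<open>Suc c\<close>; distinct steps still charge distinct sites.\<close>
    also have "\<dots> \<le> (\<Sum>c=a..<b. h (Suc c))"
      by (intro sum_mono step) (use ab in auto)
    also have "\<dots> = (\<Sum>c\<in>Suc ` {a..<b}. h c)"
      by (subst sum.reindex) (simp_all del: image_Suc_atLeastLessThan)
    also have "\<dots> \<le> (\<Sum>c<L. h c)"
      by (intro sum_mono2) (use ab h0 in auto)
    finally show ?thesis .
  qed
  then have "u * osc j f x \<le> u * (\<Sum>c<L. h c)"
    using u ab by (intro mult_left_mono) auto
  also have "\<dots> \<le> (\<Sum>c<L. w c * h c)"
    unfolding sum_distrib_left by (intro sum_mono mult_right_mono u h0) auto
  also have "\<dots> = av j (dil j f) x - av j f x"
    by (simp add: av_def h_def g_def right_diff_distrib sum_subtractf)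
  finally show ?thesis .
qed

fun dill :: "nat list \<Rightarrow> ((nat \<Rightarrow> nat) \<Rightarrow> real) \<Rightarrow> (nat \<Rightarrow> nat) \<Rightarrow> real" where
  "dill [] f = f"
| "dill (j # js) f = dil j (dill js f)"

lemma le_dill: "f x \<le> dill js f x"
  by (induction js) (auto intro: order_trans le_dil)

text \<open>Each coordinate occurs only once in \<open>js\<close>, so the successive moves of one
  site never accumulate in a coordinate.\<close>

lemma dill_leI:
  assumes "distinct js"
    and "\<And>y. (\<And>k. y k \<le> x k + 1 \<and> x k \<le> y k + 1) \<Longrightarrow> (\<And>k. k \<notin> set js \<Longrightarrow> y k = x k) \<Longrightarrow> f y \<le> c"
  shows "dill js f x \<le> c"
  using assms
proof (induction js arbitrary: x)
  case (Cons j js)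
  have *: "dill js f (x(j := b)) \<le> c" if b: "b \<le> x j + 1" "x j \<le> b + 1" for b
  proof (rule Cons.IH)
    fix y assume y: "\<And>k. y k \<le> (x(j := b)) k + 1 \<and> (x(j := b)) k \<le> y k + 1"
      "\<And>k. k \<notin> set js \<Longrightarrow> y k = (x(j := b)) k"
    show "f y \<le> c"
    proof (rule Cons.prems)
      show "y k \<le> x k + 1 \<and> x k \<le> y k + 1" for k
      proof (cases "k = j")
        case True
        then show ?thesis using y(2)[of j] Cons.prems(1) b by simp
      qed (use y(1)[of k] in simp)
      show "y k = x k" if "k \<notin> set (j # js)" for k using that y(2)[of k] by simp
    qed
  qed (use Cons.prems in simp)
  show ?case unfolding dill.simps
    by (rule dil_leI) (use * *[of "x j"] in auto)
qed auto

text \<open>Dilate in one coordinate after the other. Each stage raises the mean by at least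
  \<open>u\<close> times the mean oscillation of the current function, which lies between
  \<open>f\<close> and \<open>f + c\<close> and so oscillates by at least
  \<open>osc j f - c\<close>. All stages together raise the mean by at most
  \<open>c\<close>.\<close>

lemma sum_osc_le:
  assumes u: "0 < u" "\<And>a. a < L \<Longrightarrow> u \<le> w a" and js: "distinct js"
    and lip: "\<And>x y. (\<And>k. y k \<le> x k + 1 \<and> x k \<le> y k + 1) \<Longrightarrow> f y \<le> f x + c"
  shows "(\<Sum>j\<leftarrow>js. avl js (osc j f) x) \<le> c / u + c * length js"
proof -
  have up: "dill is f y \<le> f y + c" if "distinct is" for "is" y
    by (rule dill_leI[OF that]) (rule lip)
  have "u * (\<Sum>j\<leftarrow>is. avl js (osc j f) x - c) \<le> avl js (dill is f) x - avl js f x"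
    if "set is \<subseteq> set js" "distinct is" for "is"
    using that
  proof (induction "is")
    case (Cons j "is")
    then have j: "j \<in> set js" "distinct is" by auto
    have "u * (avl js (osc j f) x - c) = avl js (\<lambda>y. u * (osc j f y - c)) x"
      by (simp add: avl_cmult avl_diff avl_const)
    also have "\<dots> \<le> avl js (\<lambda>y. av j (dil j (dill is f)) y - av j (dill is f) y) x"
    proof (rule avl_mono)
      fix y
      have "osc j f y - c \<le> osc j (dill is f) y"
      proof -
        obtain a b where "a < L" "b < L" "osc j f y = f (y(j := a)) - f (y(j := b))"
          by (rule osc_attained)
        then show ?thesis
          using osc_ge[of a b "dill is f" y j] le_dill[of f "y(j := a)" "is"] up[OF j(2), of "y(j := b)"]
          by linarith
      qed
      then have "u * (osc j f y - c) \<le> u * osc j (dill is f) y"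
        using u by simp
      also have "\<dots> \<le> av j (dil j (dill is f)) y - av j (dill is f) y"
        by (rule dil_gain) (use u in auto)
      finally show "u * (osc j f y - c) \<le> av j (dil j (dill is f)) y - av j (dill is f) y" .
    qed
    also have "\<dots> = avl js (dill (j # is) f) x - avl js (dill is f) x"
      by (simp add: avl_diff avl_absorb[OF j(1)])
    finally show ?case
      using Cons by (simp add: distrib_left)
  qed simp
  from this[of js] js have "u * (\<Sum>j\<leftarrow>js. avl js (osc j f) x - c) \<le> avl js (dill js f) x - avl js f x"
    by simp
  also have "\<dots> \<le> avl js (\<lambda>y. f y + c) x - avl js f x"
    by (intro diff_right_mono avl_mono up js)
  also have "\<dots> = c" by (simp add: avl_add avl_const)
  finally have "(\<Sum>j\<leftarrow>js. avl js (osc j f) x - c) \<le> c / u"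
    using u by (simp add: le_divide_eq mult.commute)
  moreover have "(\<Sum>j\<leftarrow>is. avl js (osc j f) x - c) = (\<Sum>j\<leftarrow>is. avl js (osc j f) x) - c * length is" for "is"
    by (induction "is") (simp_all add: algebra_simps)
  ultimately show ?thesis by simp
qed

section \<open>Averages over blocks\<close>

definition bav :: "nat \<Rightarrow> ((nat \<Rightarrow> nat) \<Rightarrow> real) \<Rightarrow> (nat \<Rightarrow> nat) \<Rightarrow> real" where
  "bav j f x = (\<Sum>b = x j div R * R..<x j div R * R + R. f (x(j := b))) / R"

fun bavl :: "nat list \<Rightarrow> ((nat \<Rightarrow> nat) \<Rightarrow> real) \<Rightarrow> (nat \<Rightarrow> nat) \<Rightarrow> real" where
  "bavl [] f = f"
| "bavl (j # js) f = bav j (bavl js f)"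

lemma bav_mono:
  assumes "\<And>b. b div R = x j div R \<Longrightarrow> f (x(j := b)) \<le> g (x(j := b))"
  shows "bav j f x \<le> bav j g x"
  unfolding bav_def
  by (intro divide_right_mono sum_mono assms) (simp_all add: in_block_iff del: atLeastLessThan_iff)

lemma bav_const: "bav j (\<lambda>x. c) x = c"
  using R_pos by (simp add: bav_def)

lemma bavl_const: "bavl js (\<lambda>x. c) = (\<lambda>x. c)"
  by (induction js) (auto simp: bav_const)

lemma bavl_mono:
  assumes "\<And>y. (\<And>k. y k div R = x k div R) \<Longrightarrow> f y \<le> g y"
  shows "bavl js f x \<le> bavl js g x"
  using assms
proof (induction js arbitrary: x)
  case (Cons j js)
  show ?case unfolding bavl.simps
  proof (rule bav_mono, rule Cons.IH)
    fix b y assume b: "b div R = x j div R" and y: "\<And>k. y k div R = (x(j := b)) k div R"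
    show "f y \<le> g y"
    proof (rule Cons.prems)
      show "y k div R = x k div R" for k using y[of k] b by (cases "k = j") auto
    qed
  qed
qed simp

lemma bavl_le:
  assumes "\<And>y. (\<And>k. y k div R = x k div R) \<Longrightarrow> f y \<le> c"
  shows "bavl js f x \<le> c"
  using bavl_mono[of x f "\<lambda>_. c" js] assms by (simp add: bavl_const)

lemma bavl_ge:
  assumes "\<And>y. (\<And>k. y k div R = x k div R) \<Longrightarrow> c \<le> f y"
  shows "c \<le> bavl js f x"
  using bavl_mono[of x "\<lambda>_. c" f js] assms by (simp add: bavl_const)

text \<open>The weight \<open>w\<close> is constant on each block, so averaging evenly inside the
  blocks preserves the mean.\<close>

lemma av_bav: "av j (bav j f) x = av j f x"
proof -
  let ?g = "\<lambda>b. f (x(j := b))"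
  have "av j (bav j f) x = (\<Sum>i<n. \<Sum>a=i*R..<i*R+R. w a * ((\<Sum>b=i*R..<i*R+R. ?g b) / R))"
    unfolding av_def sum_blocks
    by (intro sum.cong refl) (simp add: bav_def in_block_iff del: atLeastLessThan_iff)
  also have "\<dots> = (\<Sum>i<n. p i * ((\<Sum>b=i*R..<i*R+R. ?g b) / R))"
    by (simp only: sum_w_block flip: sum_distrib_right)
  also have "\<dots> = (\<Sum>i<n. \<Sum>b=i*R..<i*R+R. w b * ?g b)"
  proof (intro sum.cong refl)
    fix i
    have "(\<Sum>b=i*R..<i*R+R. w b * ?g b) = (\<Sum>b=i*R..<i*R+R. p i / R * ?g b)"
      by (intro sum.cong refl) (simp add: w_def in_block_iff del: atLeastLessThan_iff)
    then show "p i * ((\<Sum>b=i*R..<i*R+R. ?g b) / R) = (\<Sum>b=i*R..<i*R+R. w b * ?g b)"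
      by (simp only: flip: sum_distrib_left) simp
  qed
  also have "\<dots> = av j f x" unfolding av_def sum_blocks ..
  finally show ?thesis .
qed

lemma avl_bav: "j \<in> set js \<Longrightarrow> avl js (bav j f) = avl js f"
proof -
  assume j: "j \<in> set js"
  have "av j (bav j f) = av j f" by (rule ext) (rule av_bav)
  then show ?thesis using avl_absorb[OF j, of "bav j f"] avl_absorb[OF j, of f] by simp
qed

lemma avl_bavl: "set is \<subseteq> set js \<Longrightarrow> avl js (bavl is f) = avl js f"
  by (induction "is") (simp_all add: avl_bav)

lemma block_lt_L: "b div R = a div R \<Longrightarrow> a < L \<Longrightarrow> b < L"
  by (metis L_def R_pos div_less_n div_less_iff_less_mult)

text \<open>For \<open>i = j\<close>, block averages lie between the extreme values of
  \<open>f\<close> in this coordinate, and \<open>osc j f\<close> is constant in it. For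
  \<open>i \<noteq> j\<close>, a difference of block averages is the block average of the
  differences.\<close>

lemma osc_bav_le: "osc i (bav j f) x \<le> bav j (osc i f) x"
proof (cases "i = j")
  case True
  have "bav j (osc j f) x = bav j (\<lambda>y. osc j f x) x"
    by (simp add: bav_def osc_upd)
  then have *: "bav j (osc j f) x = osc j f x" by (simp add: bav_const)
  have "osc j (bav j f) x \<le> osc j f x"
  proof (rule osc_leI)
    fix a b assume ab: "a < L" "b < L"
    obtain m where m: "m < L" "\<And>c. c < L \<Longrightarrow> f (x(j := c)) \<le> f (x(j := m))"
    proof -
      let ?S = "(\<lambda>c. f (x(j := c))) ` {..<L}"
      have "Max ?S \<in> ?S" using L_pos by (intro Max_in) auto
      then obtain m where "m < L" "Max ?S = f (x(j := m))" by auto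
      moreover have "f (x(j := c)) \<le> Max ?S" if "c < L" for c using that by (intro Max_ge) auto
      ultimately show thesis using that by metis
    qed
    obtain l where l: "l < L" "\<And>c. c < L \<Longrightarrow> f (x(j := l)) \<le> f (x(j := c))"
    proof -
      let ?S = "(\<lambda>c. f (x(j := c))) ` {..<L}"
      have "Min ?S \<in> ?S" using L_pos by (intro Min_in) auto
      then obtain m where "m < L" "Min ?S = f (x(j := m))" by auto
      moreover have "Min ?S \<le> f (x(j := c))" if "c < L" for c using that by (intro Min_le) auto
      ultimately show thesis using that by metis
    qed
    have "bav j f (x(j := a)) \<le> bav j (\<lambda>y. f (x(j := m))) (x(j := a))"
      by (rule bav_mono) (use ab m block_lt_L in auto)
    moreover have "bav j (\<lambda>y. f (x(j := l))) (x(j := b)) \<le> bav j f (x(j := b))"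
      by (rule bav_mono) (use ab l block_lt_L in auto)
    ultimately have "bav j f (x(j := a)) - bav j f (x(j := b)) \<le> f (x(j := m)) - f (x(j := l))"
      by (simp add: bav_const)
    also have "\<dots> \<le> osc j f x" using m l by (intro osc_ge)
    finally show "bav j f (x(j := a)) - bav j f (x(j := b)) \<le> osc j f x" .
  qed
  then show ?thesis using * True by simp
next
  case False
  show ?thesis
  proof (rule osc_leI)
    fix a b assume ab: "a < L" "b < L"
    have "bav j f (x(i := a)) - bav j f (x(i := b)) =
      (\<Sum>c = x j div R * R..<x j div R * R + R. f (x(j := c, i := a)) - f (x(j := c, i := b))) / R"
      using False by (simp add: bav_def sum_subtractf diff_divide_distrib fun_upd_twist[OF False])
    also have "\<dots> \<le> bav j (osc i f) x"
      unfolding bav_def by (intro divide_right_mono sum_mono osc_ge ab) auto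
    finally show "bav j f (x(i := a)) - bav j f (x(i := b)) \<le> bav j (osc i f) x" .
  qed
qed

lemma osc_bavl_le: "osc i (bavl js f) x \<le> bavl js (osc i f) x"
proof (induction js arbitrary: x)
  case (Cons j js)
  have "osc i (bav j (bavl js f)) x \<le> bav j (osc i (bavl js f)) x" by (rule osc_bav_le)
  also have "\<dots> \<le> bav j (bavl js (osc i f)) x" by (rule bav_mono) (rule Cons.IH)
  finally show ?case by simp
qed simp

lemma block_const_bav: "block_const j (bav j f)"
  by (auto simp: block_const_def bav_def)

lemma block_const_bav_other:
  assumes "block_const i f"
  shows "block_const i (bav j f)"
proof (cases "i = j")
  case False
  show ?thesis unfolding block_const_def
  proof (intro allI impI)
    fix x a b assume ab: "a div R = b div R"
    have "f (x(i := a, j := c)) = f (x(i := b, j := c))" for c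
      unfolding fun_upd_twist[OF False] using assms ab unfolding block_const_def by blast
    then show "bav j f (x(i := a)) = bav j f (x(i := b))"
      using False by (simp add: bav_def)
  qed
qed (simp add: block_const_bav)

lemma block_const_bavl: "i \<in> set js \<Longrightarrow> block_const i (bavl js f)"
  by (induction js) (auto simp: block_const_bav block_const_bav_other)

lemma block_const_av:
  assumes "block_const i f"
  shows "block_const i (av j f)"
proof (cases "i = j")
  case True
  then show ?thesis by (simp add: block_const_def av_upd)
next
  case False
  show ?thesis unfolding block_const_def
  proof (intro allI impI)
    fix x a b assume ab: "a div R = b div R"
    have "f (x(i := a, j := c)) = f (x(i := b, j := c))" for c
      unfolding fun_upd_twist[OF False] using assms ab unfolding block_const_def by blast
    then show "av j f (x(i := a)) = av j f (x(i := b))"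
      by (simp add: av_def)
  qed
qed

lemma block_const_avl: "block_const i f \<Longrightarrow> block_const i (avl js f)"
  by (induction js) (auto simp: block_const_av)

lemma block_const_diff: "block_const i f \<Longrightarrow> block_const i g \<Longrightarrow> block_const i (\<lambda>x. f x - g x)"
  unfolding block_const_def by metis

section \<open>Approximation by juntas\<close>

text \<open>Pythagoras: \<open>avl ts\<close> is an orthogonal projection in L^2, so the cross term
  has the same mean as the square of the projection.\<close>

lemma avl_square_diff:
  assumes "set ts \<subseteq> set js"
  shows "avl js (\<lambda>x. (f x - avl ts f x)\<^sup>2) x = avl js (\<lambda>x. (f x)\<^sup>2) x - avl js (\<lambda>x. (avl ts f x)\<^sup>2) x"
proof -
  have "avl js (\<lambda>x. f x * avl ts f x) = avl js (avl ts (\<lambda>x. f x * avl ts f x))"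
    by (rule avl_absorb_list[OF assms, symmetric])
  also have "avl ts (\<lambda>x. f x * avl ts f x) = (\<lambda>x. (avl ts f x)\<^sup>2)"
    by (subst avl_pull) (simp_all add: avl_upd power2_eq_square)
  finally have cross: "avl js (\<lambda>x. f x * avl ts f x) = avl js (\<lambda>x. (avl ts f x)\<^sup>2)" .
  have "(\<lambda>x. (f x - avl ts f x)\<^sup>2) = (\<lambda>x. (f x)\<^sup>2 - 2 * (f x * avl ts f x) + (avl ts f x)\<^sup>2)"
    by (rule ext) (simp add: power2_eq_square algebra_simps)
  then show ?thesis
    by (simp add: avl_add avl_diff avl_cmult cross)
qed

lemma avl_abs_diff_le_osc:
  assumes "j \<in> set js"
  shows "avl js (\<lambda>x. \<bar>f x - av j f x\<bar>) x \<le> avl js (osc j f) x"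
proof (rule avl_mono)
  fix y assume y: "\<And>k. k \<in> set js \<Longrightarrow> y k < L"
  have yj: "y j < L" using y assms by simp
  have 1: "f y - f (y(j := a)) \<le> osc j f y" "f (y(j := a)) - f y \<le> osc j f y" if "a < L" for a
    using osc_ge[OF yj that, of f y j] osc_ge[OF that yj, of f y j] by simp_all
  have "av j (\<lambda>z. f y - osc j f y) y \<le> av j f y" "av j f y \<le> av j (\<lambda>z. f y + osc j f y) y"
    using 1 by (force intro!: av_mono simp: algebra_simps)+
  then show "\<bar>f y - av j f y\<bar> \<le> osc j f y" by (simp add: av_const)
qed

text \<open>The martingale argument of Falik and Samorodnitsky: the differences
  \<open>avl ts f - avl (j # ts) f\<close> have small \<open>L\<^sup>1\<close> norm and their energies add up to
  at most the energy of \<open>f\<close>, so \<open>super_poincare\<close> can be summed over \<open>j\<close>.\<close>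

lemma variance_le:
  assumes f: "\<And>j. j \<in> set js \<Longrightarrow> block_const j f" and l: "0 < l" "\<And>i. i < n \<Longrightarrow> l \<le> p i"
    and f01: "\<And>x. 0 \<le> f x" "\<And>x. f x \<le> 1" and Z: "1 < Z"
    and ts: "set ts \<subseteq> set js"
  shows "avl js (\<lambda>x. (f x - avl ts f x)\<^sup>2) x \<le> Z * (\<Sum>j\<leftarrow>ts. (avl js (osc j f) x)\<^sup>2)
     + 4 / (l * ln Z) * (\<Sum>j\<leftarrow>js. avl js (\<lambda>x. (f x - av j f x)\<^sup>2) x)"
proof -
  define c where "c = 4 / (l * ln Z)"
  have c: "0 \<le> c" using l Z by (simp add: c_def)
  define F where "F i x = f x - av i f x" for i x
  have F_eq: "avl us (F i) = (\<lambda>x. avl us f x - av i (avl us f) x)" for us i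
  proof -
    have "F i = (\<lambda>x. f x - av i f x)" by (rule ext) (rule F_def)
    then show ?thesis by (simp add: avl_diff avl_av_commute)
  qed
  have sq: "avl js (\<lambda>x. (g x - av j g x)\<^sup>2) x = avl js (\<lambda>x. (g x)\<^sup>2) x - avl js (\<lambda>x. (av j g x)\<^sup>2) x"
    if "j \<in> set js" for g j
    using avl_square_diff[of "[j]" js g x] that by simp
  \<comment> \<open>Strengthened for the induction: the energy still left in the averages
    \<open>avl us (F i)\<close> is subtracted on the right, so that the energies of the successive
    differences telescope.\<close>
  have "avl js (\<lambda>x. (f x)\<^sup>2) x - avl js (\<lambda>x. (avl us f x)\<^sup>2) x \<le> Z * (\<Sum>j\<leftarrow>us. (avl js (osc j f) x)\<^sup>2)
     + c * (\<Sum>i\<leftarrow>js. avl js (\<lambda>x. (F i x)\<^sup>2) x - avl js (\<lambda>x. (avl us (F i) x)\<^sup>2) x)"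
    if "set us \<subseteq> set js" for us
    using that
  proof (induction us)
    case (Cons j us)
    then have j: "j \<in> set js" and us: "set us \<subseteq> set js" by auto
    define d where "d x = avl us f x - av j (avl us f) x" for x
    have d_eq: "d = avl us (F j)" unfolding F_eq d_def by simp
    have avl01: "0 \<le> avl vs f y" "avl vs f y \<le> 1" for vs y
      using avl_nonneg[of f vs y] avl_mono[of vs y f "\<lambda>_. 1"] f01 by (simp_all add: avl_const)
    have "avl js (\<lambda>x. (avl us f x)\<^sup>2) x - avl js (\<lambda>x. (avl (j # us) f x)\<^sup>2) x = avl js (\<lambda>x. (d x)\<^sup>2) x"
      unfolding d_def by (simp add: sq[OF j])
    also have "\<dots> \<le> Z * (avl js (\<lambda>x. \<bar>d x\<bar>) x)\<^sup>2
       + c * (\<Sum>i\<leftarrow>js. avl js (\<lambda>x. (d x - av i d x)\<^sup>2) x)"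
      unfolding c_def
    proof (rule super_poincare[OF _ l _ Z])
      show "block_const i d" if "i \<in> set js" for i
        unfolding d_def by (intro block_const_diff block_const_av block_const_avl f that)
      show "\<bar>d y\<bar> \<le> 1" for y
        using avl01[of us y] avl01[of "j # us" y] unfolding d_def by (simp add: abs_le_iff)
    qed
    also have "(avl js (\<lambda>x. \<bar>d x\<bar>) x)\<^sup>2 \<le> (avl js (osc j f) x)\<^sup>2"
    proof (rule power_mono)
      have "avl js (\<lambda>x. \<bar>d x\<bar>) x \<le> avl js (avl us (\<lambda>x. \<bar>F j x\<bar>)) x"
        unfolding d_eq by (intro avl_mono avl_abs)
      also have "\<dots> = avl js (\<lambda>x. \<bar>F j x\<bar>) x"
        by (simp add: avl_absorb_list[OF us])
      also have "\<dots> \<le> avl js (osc j f) x"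
        unfolding F_def by (rule avl_abs_diff_le_osc[OF j])
      finally show "avl js (\<lambda>x. \<bar>d x\<bar>) x \<le> avl js (osc j f) x" .
    qed (rule avl_nonneg, simp)
    also have "(\<Sum>i\<leftarrow>js. avl js (\<lambda>x. (d x - av i d x)\<^sup>2) x) =
      (\<Sum>i\<leftarrow>js. avl js (\<lambda>x. (avl us (F i) x)\<^sup>2) x - avl js (\<lambda>x. (avl (j # us) (F i) x)\<^sup>2) x)"
    proof -
      have "avl js (\<lambda>x. (d x - av i d x)\<^sup>2) x =
         avl js (\<lambda>x. (avl us (F i) x)\<^sup>2) x - avl js (\<lambda>x. (avl (j # us) (F i) x)\<^sup>2) x" for i
      proof -
        \<comment> \<open>Subtracting the average over \<open>i\<close> commutes with the other
          averages. So the fluctuation of \<open>d\<close> in coordinate \<open>i\<close> is the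
          martingale difference of \<open>F i\<close>, whose mean square is a difference of two by
          Pythagoras.\<close>
        have "(\<lambda>x. d x - av i d x) = (\<lambda>x. avl us (F i) x - av j (avl us (F i)) x)"
        proof -
          have "d = (\<lambda>x. avl us f x - av j (avl us f) x)" by (rule ext) (rule d_def)
          then show ?thesis by (simp add: F_eq av_diff av_commute[of i j] algebra_simps)
        qed
        then have "(\<lambda>x. (d x - av i d x)\<^sup>2) = (\<lambda>x. (avl us (F i) x - av j (avl us (F i)) x)\<^sup>2)"
          by (simp add: fun_eq_iff)
        then show ?thesis using sq[OF j, of "avl us (F i)"] by simp
      qed
      then show ?thesis by simp
    qed
    finally have *: "avl js (\<lambda>x. (avl us f x)\<^sup>2) x - avl js (\<lambda>x. (avl (j # us) f x)\<^sup>2) x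
      \<le> Z * (avl js (osc j f) x)\<^sup>2
        + c * (\<Sum>i\<leftarrow>js. avl js (\<lambda>x. (avl us (F i) x)\<^sup>2) x - avl js (\<lambda>x. (avl (j # us) (F i) x)\<^sup>2) x)"
      using Z by simp
    show ?case using Cons.IH[OF us] *
      by (simp add: sum_list_subtractf algebra_simps)
  qed simp
  from this[OF ts] have "avl js (\<lambda>x. (f x - avl ts f x)\<^sup>2) x \<le> Z * (\<Sum>j\<leftarrow>ts. (avl js (osc j f) x)\<^sup>2)
     + c * (\<Sum>i\<leftarrow>js. avl js (\<lambda>x. (F i x)\<^sup>2) x - avl js (\<lambda>x. (avl ts (F i) x)\<^sup>2) x)"
    unfolding avl_square_diff[OF ts] .
  also have "\<dots> \<le> Z * (\<Sum>j\<leftarrow>ts. (avl js (osc j f) x)\<^sup>2) + c * (\<Sum>i\<leftarrow>js. avl js (\<lambda>x. (F i x)\<^sup>2) x)"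
    by (intro add_left_mono mult_left_mono sum_list_mono c) (simp add: avl_nonneg)
  finally show ?thesis by (simp add: c_def F_def)
qed

text \<open>On \<open>ts\<close>, squared mean oscillations are at most \<open>e\<close> times the
  mean oscillations. Since \<open>\<bar>f - av j f\<bar> \<le> 1\<close>, the energies are at most
  the mean oscillations too, so \<open>C\<close> controls both sums in
  \<open>variance_le\<close>.\<close>

lemma junta_approximation:
  assumes f: "\<And>j. j \<in> set js \<Longrightarrow> block_const j f" and l: "0 < l" "\<And>i. i < n \<Longrightarrow> l \<le> p i"
    and f01: "\<And>x. 0 \<le> f x" "\<And>x. f x \<le> 1" and Z: "1 < Z" and e: "0 \<le> e"
    and js: "distinct js" and ts: "set ts \<subseteq> set js" "distinct ts"
    and C: "(\<Sum>j\<leftarrow>js. avl js (osc j f) x) \<le> C"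
    and small: "\<And>j. j \<in> set ts \<Longrightarrow> avl js (osc j f) x \<le> e"
  shows "avl js (\<lambda>x. (f x - avl ts f x)\<^sup>2) x \<le> Z * (e * C) + 4 * C / (l * ln Z)"
proof -
  let ?a = "\<lambda>j. avl js (osc j f) x"
  have a0: "0 \<le> ?a j" for j by (rule avl_nonneg) (rule osc_nonneg)
  have sum_list_js: "(\<Sum>j\<leftarrow>is. g j) = (\<Sum>j\<in>set is. g j)" if "distinct is" for g :: "nat \<Rightarrow> real" and "is"
    using that by (simp add: sum_list_distinct_conv_sum_set)
  have "(\<Sum>j\<leftarrow>ts. (?a j)\<^sup>2) \<le> e * C"
  proof -
    have "(\<Sum>j\<leftarrow>ts. (?a j)\<^sup>2) \<le> (\<Sum>j\<leftarrow>ts. e * ?a j)"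
      by (intro sum_list_mono) (use small a0 in \<open>auto simp: power2_eq_square intro: mult_right_mono\<close>)
    also have "\<dots> = e * (\<Sum>j\<in>set ts. ?a j)"
      using sum_list_js[OF ts(2)] by (simp add: sum_distrib_left)
    also have "\<dots> \<le> e * (\<Sum>j\<in>set js. ?a j)"
      by (intro mult_left_mono sum_mono2) (use ts a0 e in auto)
    also have "\<dots> \<le> e * C"
      using C e sum_list_js[OF js] by (intro mult_left_mono) auto
    finally show ?thesis .
  qed
  moreover have "(\<Sum>j\<leftarrow>js. avl js (\<lambda>x. (f x - av j f x)\<^sup>2) x) \<le> (\<Sum>j\<leftarrow>js. ?a j)"
  proof (rule sum_list_mono)
    fix j assume j: "j \<in> set js"
    have "avl js (\<lambda>x. (f x - av j f x)\<^sup>2) x \<le> avl js (\<lambda>x. \<bar>f x - av j f x\<bar>) x"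
    proof (rule avl_mono)
      fix y
      have "0 \<le> av j f y" "av j f y \<le> 1"
        using av_nonneg[of f j y] av_mono[of f y j "\<lambda>_. 1"] f01 by (simp_all add: av_const)
      then have "\<bar>f y - av j f y\<bar> \<le> 1" using f01[of y] by linarith
      then show "(f y - av j f y)\<^sup>2 \<le> \<bar>f y - av j f y\<bar>"
        using mult_left_le[of "\<bar>f y - av j f y\<bar>" "\<bar>f y - av j f y\<bar>"] by (simp add: power2_eq_square abs_mult_self_eq)
    qed
    also have "\<dots> \<le> ?a j" by (rule avl_abs_diff_le_osc[OF j])
    finally show "avl js (\<lambda>x. (f x - av j f x)\<^sup>2) x \<le> ?a j" .
  qed
  ultimately have "avl js (\<lambda>x. (f x - avl ts f x)\<^sup>2) x \<le> Z * (e * C) + 4 / (l * ln Z) * C"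
    using C l Z
    by (intro order_trans[OF variance_le[OF f l f01 Z ts(1)]] add_mono mult_left_mono) auto
  then show ?thesis by simp
qed

section \<open>The truncated distance and its block average\<close>

definition near :: "(nat \<Rightarrow> nat) set \<Rightarrow> nat set \<Rightarrow> nat \<Rightarrow> (nat \<Rightarrow> nat) \<Rightarrow> bool" where
  "near S J t y \<longleftrightarrow> (\<exists>a\<in>S. \<forall>k\<in>J. y k \<le> a k + t \<and> a k \<le> y k + t)"

text \<open>The \<open>\<ell>\<^sup>\<infinity>\<close>-distance to \<open>S\<close> in units of \<open>R\<close>, minus one, truncated to \<open>[0, 1]\<close>.\<close>

definition far :: "(nat \<Rightarrow> nat) set \<Rightarrow> nat set \<Rightarrow> (nat \<Rightarrow> nat) \<Rightarrow> real" where
  "far S J y = card {t \<in> {R..<2 * R}. \<not> near S J t y} / R"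

lemma far_bounds: "0 \<le> far S J y" "far S J y \<le> 1"
proof -
  have "card {t \<in> {R..<2 * R}. \<not> near S J t y} \<le> card {R..<2 * R}"
    by (intro card_mono) auto
  then show "far S J y \<le> 1" using R_pos by (simp add: far_def)
qed (simp add: far_def)

lemma near_mono: "near S J t y \<Longrightarrow> t \<le> t' \<Longrightarrow> near S J t' y"
  unfolding near_def by (meson add_left_mono order_trans)

lemma near_step:
  assumes "near S J t x" "\<And>k. y k \<le> x k + 1 \<and> x k \<le> y k + 1"
  shows "near S J (Suc t) y"
proof -
  obtain a where a: "a \<in> S" "\<And>k. k \<in> J \<Longrightarrow> x k \<le> a k + t \<and> a k \<le> x k + t"
    using assms(1) unfolding near_def by blast
  have "y k \<le> a k + Suc t \<and> a k \<le> y k + Suc t" if "k \<in> J" for k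
    using a(2)[OF that] assms(2)[of k] by linarith
  then show ?thesis using a(1) unfolding near_def by blast
qed

text \<open>A threshold \<open>t > R\<close> that fails at \<open>y\<close> fails as
  \<open>t - 1\<close> at \<open>x\<close>. So the failing thresholds of \<open>y\<close> are
  shifted ones of \<open>x\<close>, plus possibly \<open>R\<close>.\<close>

lemma far_step:
  assumes "\<And>k. y k \<le> x k + 1 \<and> x k \<le> y k + 1"
  shows "far S J y \<le> far S J x + 1 / R"
proof -
  let ?T = "\<lambda>y. {t \<in> {R..<2 * R}. \<not> near S J t y}"
  have "?T y \<subseteq> insert R (Suc ` ?T x)"
  proof
    fix t assume t: "t \<in> ?T y"
    show "t \<in> insert R (Suc ` ?T x)"
    proof (cases "t = R")
      case False
      then obtain s where s: "t = Suc s" "R \<le> s" using t by (cases t) auto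
      then have "\<not> near S J s x" using near_step[OF _ assms] t by auto
      then show ?thesis using s t by auto
    qed simp
  qed
  then have "card (?T y) \<le> card (insert R (Suc ` ?T x))"
    by (intro card_mono) auto
  also have "\<dots> \<le> Suc (card (?T x))"
    using card_image[of Suc "?T x"] by (simp add: card_insert_if)
  finally have "real (card (?T y)) \<le> card (?T x) + 1" by linarith
  then show ?thesis
    unfolding far_def using R_pos by (simp add: divide_right_mono flip: add_divide_distrib)
qed

lemma far_eq_0: "near S J R y \<Longrightarrow> far S J y = 0"
  using near_mono[of S J R y] by (auto simp: far_def)

lemma far_less_1D:
  assumes "far S J y < 1"
  shows "near S J (2 * R) y"
proof (rule ccontr)
  assume "\<not> near S J (2 * R) y"
  then have "{t \<in> {R..<2 * R}. \<not> near S J t y} = {R..<2 * R}"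
    using near_mono[of S J _ y "2 * R"] by fastforce
  then show False using assms R_pos by (simp add: far_def)
qed

text \<open>The function \<open>H\<close>. Block averaging makes it constant on blocks, as
  \<open>ent_square_le\<close> requires, without increasing the mean oscillations of
  \<open>far\<close>.\<close>

definition smooth :: "(nat \<Rightarrow> nat) set \<Rightarrow> nat list \<Rightarrow> (nat \<Rightarrow> nat) \<Rightarrow> real" where
  "smooth S js = bavl js (far S (set js))"

lemma smooth_bounds: "0 \<le> smooth S js y" "smooth S js y \<le> 1"
  unfolding smooth_def by (intro bavl_ge bavl_le far_bounds)+

text \<open>Block averaging moves a coordinate by less than \<open>R\<close> sites, and the
  thresholds in \<open>far\<close> start at \<open>R\<close>; so only zeros are averaged.\<close>

lemma smooth_eq_0:
  assumes "y \<in> S"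
  shows "smooth S js y = 0"
proof (rule antisym)
  show "smooth S js y \<le> 0" unfolding smooth_def
  proof (rule bavl_le)
    fix z assume z: "\<And>k. z k div R = y k div R"
    have "z k \<le> y k + R \<and> y k \<le> z k + R" for k
    proof -
      have "z k = y k div R * R + z k mod R" "y k = y k div R * R + y k mod R"
        using div_mult_mod_eq[of "z k" R] z[of k] by simp_all
      moreover have "z k mod R < R" "y k mod R < R" using R_pos by simp_all
      ultimately show ?thesis by linarith
    qed
    then have "near S (set js) R z" using assms unfolding near_def by blast
    then show "far S (set js) z \<le> 0" by (simp add: far_eq_0)
  qed
qed (rule smooth_bounds)

text \<open>An average below \<open>1\<close> needs a point with \<open>far < 1\<close> in the same
  blocks. This point is within \<open>2 * R\<close> sites of \<open>S\<close>, which amounts to at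
  most two blocks.\<close>

lemma smooth_less_1D:
  assumes "smooth S js y < 1"
  obtains a where "a \<in> S" "\<And>k. k \<in> set js \<Longrightarrow> y k div R \<le> a k div R + 2 \<and> a k div R \<le> y k div R + 2"
proof -
  have "\<exists>z. (\<forall>k. z k div R = y k div R) \<and> far S (set js) z < 1"
  proof (rule ccontr)
    assume "\<not> ?thesis"
    then have "1 \<le> smooth S js y" unfolding smooth_def by (intro bavl_ge) (meson not_le)
    then show False using assms by simp
  qed
  then obtain z where z: "\<And>k. z k div R = y k div R" "near S (set js) (2 * R) z"
    using far_less_1D by blast
  then obtain a where a: "a \<in> S" "\<And>k. k \<in> set js \<Longrightarrow> z k \<le> a k + 2 * R \<and> a k \<le> z k + 2 * R"
    unfolding near_def by blast
  have "y k div R \<le> a k div R + 2 \<and> a k div R \<le> y k div R + 2" if "k \<in> set js" for k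
  proof -
    have "(c + 2 * R) div R = c div R + 2" for c using R_pos by simp
    then show ?thesis
      using a(2)[OF that] z(1)[of k] div_le_mono[of "z k" "a k + 2 * R" R] div_le_mono[of "a k" "z k + 2 * R" R]
      by simp
  qed
  then show thesis using a(1) that by blast
qed

text \<open>Apply \<open>sum_osc_le\<close> with \<open>c = 1 / R\<close> from
  \<open>far_step\<close> and \<open>u = l / R\<close>, a lower bound for the mass of a site. Then
  \<open>R\<close> cancels in \<open>c / u\<close>, and \<open>length js \<le> R\<close> bounds the
  other term by \<open>1\<close>.\<close>

lemma sum_osc_smooth:
  assumes l: "0 < l" "\<And>i. i < n \<Longrightarrow> l \<le> p i" and js: "distinct js" "length js \<le> R"
  shows "(\<Sum>j\<leftarrow>js. avl js (osc j (smooth S js)) x) \<le> 1 / l + 1"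
proof -
  let ?f = "far S (set js)"
  have "(\<Sum>j\<leftarrow>js. avl js (osc j (smooth S js)) x) \<le> (\<Sum>j\<leftarrow>js. avl js (osc j ?f) x)"
  proof (rule sum_list_mono)
    fix j
    have "avl js (osc j (smooth S js)) x \<le> avl js (bavl js (osc j ?f)) x"
      unfolding smooth_def by (intro avl_mono osc_bavl_le)
    then show "avl js (osc j (smooth S js)) x \<le> avl js (osc j ?f) x"
      by (simp add: avl_bavl)
  qed
  also have "\<dots> \<le> (1 / R) / (l / R) + 1 / R * length js"
  proof (rule sum_osc_le)
    show "0 < l / R" using l R_pos by simp
    show "l / R \<le> w a" if "a < L" for a
      using l(2)[OF div_less_n[OF that]] by (simp add: w_def divide_right_mono)
  qed (use js far_step in auto)
  also have "\<dots> \<le> 1 / l + 1"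
  proof -
    have "(1 / R) / (l / R) = 1 / l" using R_pos by simp
    moreover have "1 / R * length js \<le> 1" using js R_pos by (simp add: divide_le_eq)
    ultimately show ?thesis by linarith
  qed
  finally show ?thesis .
qed

text \<open>\<open>T\<close> consists of the coordinates of mean oscillation at most
  \<open>e\<close>, and Markov's inequality bounds the number of the others. Every list
  \<open>ts\<close> inside \<open>T\<close> is allowed, so that one list can later serve two
  sets.\<close>

lemma smooth_junta:
  fixes l Z e C :: real
  assumes l: "0 < l" "\<And>i. i < n \<Longrightarrow> l \<le> p i" and js: "distinct js" "length js \<le> R"
    and Z: "1 < Z" and e: "0 < e"
    and C: "C = 1 / l + 1"
  shows "\<exists>T \<subseteq> set js. card (set js - T) * e \<le> C \<and> (\<forall>ts. set ts \<subseteq> T \<longrightarrow> distinct ts \<longrightarrow>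
    avl js (\<lambda>x. (smooth S js x - avl ts (smooth S js) x)\<^sup>2) x \<le> Z * (e * C) + 4 * C / (l * ln Z))"
proof -
  let ?a = "\<lambda>j. avl js (osc j (smooth S js)) x"
  define T where "T = {j \<in> set js. ?a j \<le> e}"
  have a0: "0 \<le> ?a j" for j by (rule avl_nonneg) (rule osc_nonneg)
  have sum: "(\<Sum>j\<leftarrow>js. ?a j) \<le> C"
    unfolding C by (rule sum_osc_smooth) (use l js in auto)
  show ?thesis
  proof (intro exI[of _ T] conjI allI impI)
    show "T \<subseteq> set js" by (auto simp: T_def)
    have "card (set js - T) * e = (\<Sum>j\<in>set js - T. e)" by simp
    also have "\<dots> \<le> (\<Sum>j\<in>set js - T. ?a j)" by (intro sum_mono) (auto simp: T_def)
    also have "\<dots> \<le> (\<Sum>j\<in>set js. ?a j)" by (intro sum_mono2) (use a0 in auto)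
    also have "\<dots> \<le> C" using sum js by (simp add: sum_list_distinct_conv_sum_set)
    finally show "card (set js - T) * e \<le> C" .
    show "avl js (\<lambda>x. (smooth S js x - avl ts (smooth S js) x)\<^sup>2) x \<le> Z * (e * C) + 4 * C / (l * ln Z)"
      if ts: "set ts \<subseteq> T" "distinct ts" for ts
      by (rule junta_approximation[OF _ l smooth_bounds Z _ js(1) _ ts(2) sum])
        (use ts e in \<open>auto simp: T_def smooth_def block_const_bavl\<close>)
  qed
qed

end

section \<open>A walk through small cells\<close>

text \<open>A point off the support has a null neighbourhood in the basis; as the basis is
  countable, the complement of the support is null.\<close>

lemma support_meets:
  fixes \<mu> :: "'a::metric_space measure"
  assumes \<mu>: "metric_prob_space \<mu>" and D: "D \<in> sets \<mu>" "0 < measure \<mu> D"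
  shows "D \<inter> spt \<mu> \<noteq> {}"
proof
  assume disj: "D \<inter> spt \<mu> = {}"
  have sets: "sets \<mu> = sets borel" using \<mu> by (simp add: metric_prob_space_def)
  obtain \<B> :: "'a set set" where \<B>: "countable \<B>" "\<And>V. V \<in> \<B> \<Longrightarrow> open V"
    "\<And>U x. open U \<Longrightarrow> x \<in> U \<Longrightarrow> \<exists>V\<in>\<B>. x \<in> V \<and> V \<subseteq> U"
    using \<mu> compact_countable_basis unfolding metric_prob_space_def by blast
  define \<N> where "\<N> = {V \<in> \<B>. V \<in> null_sets \<mu>}"
  have "countable \<N>" using \<B>(1) by (simp add: \<N>_def)
  then have "(\<Union>V\<in>\<N>. V) \<in> null_sets \<mu>"
    by (rule null_sets_UN') (simp add: \<N>_def)
  then have "\<Union>\<N> \<in> null_sets \<mu>" by simp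
  moreover have "D \<subseteq> \<Union>\<N>"
  proof
    fix x assume "x \<in> D"
    then have "x \<notin> spt \<mu>" using disj by auto
    then obtain U where U: "open U" "x \<in> U" "emeasure \<mu> U = 0"
      by (auto simp: spt_def)
    then obtain V where V: "V \<in> \<B>" "x \<in> V" "V \<subseteq> U" using \<B>(3) by blast
    have "V \<in> null_sets \<mu>"
    proof (rule null_sets_subset)
      show "U \<in> null_sets \<mu>" using U by (simp add: null_sets_def sets)
      show "V \<in> sets \<mu>" using \<B>(2)[OF V(1)] by (simp add: sets)
    qed (rule V(3))
    then show "x \<in> \<Union>\<N>" using V by (auto simp: \<N>_def)
  qed
  ultimately have "D \<in> null_sets \<mu>" using D(1) by (metis null_sets_subset)
  then show False using D by (simp add: measure_eq_0_null_sets)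
qed

text \<open>Total boundedness gives finitely many balls of radius \<open>r/2\<close>; make them
  disjoint and discard those of measure zero.\<close>

lemma finite_small_cells:
  fixes \<mu> :: "'a::metric_space measure"
  assumes \<mu>: "metric_prob_space \<mu>" and r: "0 < r"
  obtains V :: "'a set set" where "finite V" "disjoint V" "V \<subseteq> sets borel"
    "\<And>D. D \<in> V \<Longrightarrow> 0 < measure \<mu> D" "measure \<mu> (\<Union>V) = 1"
    "\<And>D x y. D \<in> V \<Longrightarrow> x \<in> D \<Longrightarrow> y \<in> D \<Longrightarrow> dist x y < r"
proof -
  interpret prob_space \<mu> using \<mu> by (simp add: metric_prob_space_def)
  have sets: "sets \<mu> = sets borel" using \<mu> by (simp add: metric_prob_space_def)
  have space: "space \<mu> = UNIV" using sets_eq_imp_space_eq[OF sets] by simp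
  have "\<exists>k. finite k \<and> (UNIV :: 'a set) \<subseteq> (\<Union>x\<in>k. ball x (r/2))"
    using \<mu> r unfolding metric_prob_space_def compact_eq_totally_bounded by simp
  then obtain k :: "'a set" where k: "finite k" "UNIV \<subseteq> (\<Union>x\<in>k. ball x (r/2))" by blast
  obtain xs where xs: "set xs = k" using finite_list[OF k(1)] by blast
  define A where "A i = ball (xs ! i) (r/2)" for i
  define D where "D i = disjointed A i" for i
  define V where "V = D ` {i \<in> {0..<length xs}. 0 < measure \<mu> (D i)}"
  have D_sets: "D i \<in> sets borel" for i
    unfolding D_def disjointed_def A_def by (intro sets.Diff sets.finite_UN) auto
  have un: "(\<Union>i\<in>{0..<length xs}. D i) = UNIV"
  proof -
    have "y \<in> (\<Union>i\<in>{0..<length xs}. A i)" for y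
    proof -
      obtain x where "x \<in> set xs" "y \<in> ball x (r/2)" using k(2) xs by blast
      moreover from this obtain i where "i < length xs" "xs ! i = x" by (meson in_set_conv_nth)
      ultimately show ?thesis by (auto simp: A_def)
    qed
    then show ?thesis unfolding D_def finite_UN_disjointed_eq by blast
  qed
  show thesis
  proof
    show "finite V" by (simp add: V_def)
    show "disjoint V"
    proof (rule disjointI)
      fix a b assume "a \<in> V" "b \<in> V" and ab: "a \<noteq> b"
      then obtain i j where ij: "a = disjointed A i" "b = disjointed A j" unfolding V_def D_def by blast
      then have "i \<noteq> j" using ab by auto
      then show "a \<inter> b = {}"
        unfolding ij by (intro disjoint_family_onD[OF disjoint_family_disjointed]) simp_all
    qed
    show "V \<subseteq> sets borel" using D_sets by (auto simp: V_def)
    show "0 < measure \<mu> D" if "D \<in> V" for D using that by (auto simp: V_def)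
    define M where "M = (\<Union>i\<in>{i \<in> {0..<length xs}. measure \<mu> (D i) = 0}. D i)"
    have "M \<in> null_sets \<mu>"
      unfolding M_def
    proof (rule null_sets_UN')
      show "D i \<in> null_sets \<mu>" if "i \<in> {i \<in> {0..<length xs}. measure \<mu> (D i) = 0}" for i
        using that by (simp add: null_sets_def sets D_sets emeasure_eq_measure)
    qed simp
    moreover have "UNIV - M \<subseteq> \<Union>V"
    proof
      fix x assume x: "x \<in> UNIV - M"
      obtain i where "i \<in> {0..<length xs}" "x \<in> D i" using un by blast
      moreover from this have "measure \<mu> (D i) \<noteq> 0" using x by (auto simp: M_def)
      ultimately show "x \<in> \<Union>V" unfolding V_def zero_less_measure_iff by blast
    qed
    moreover have "\<Union>V \<in> sets \<mu>"
      using D_sets unfolding V_def sets by auto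
    ultimately have "measure \<mu> (space \<mu> - M) \<le> measure \<mu> (\<Union>V)"
      by (intro finite_measure_mono) (simp_all add: space)
    then have "measure \<mu> (space \<mu>) \<le> measure \<mu> (\<Union>V)"
      using measure_Diff_null_set[OF sets.top \<open>M \<in> null_sets \<mu>\<close>] by simp
    then show "measure \<mu> (\<Union>V) = 1"
      using prob_le_1[of "\<Union>V"] unfolding prob_space by linarith
    show "dist x y < r" if D': "D' \<in> V" and xy: "x \<in> D'" "y \<in> D'" for D' x y
    proof -
      obtain i where "D' = disjointed A i" using D' unfolding V_def D_def by blast
      then have "x \<in> A i" "y \<in> A i" using xy disjointed_subset[of A i] by auto
      then have "dist (xs ! i) x < r / 2" "dist (xs ! i) y < r / 2"
        by (auto simp: A_def)
      then show ?thesis using dist_triangle_half_r[of "xs ! i" x r y] by simp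
    qed
  qed
qed

lemma successively_of_rtranclp:
  assumes "P\<^sup>*\<^sup>* a b"
  obtains xs where "xs \<noteq> []" "hd xs = a" "last xs = b" "successively P xs"
    "set xs \<subseteq> insert a (Collect (\<lambda>y. \<exists>x. P x y))"
proof -
  have "\<exists>xs. xs \<noteq> [] \<and> hd xs = a \<and> last xs = b \<and> successively P xs \<and>
      set xs \<subseteq> insert a (Collect (\<lambda>y. \<exists>x. P x y))"
    using assms
  proof (induction rule: rtranclp_induct)
    case base
    show ?case by (rule exI[of _ "[a]"]) simp
  next
    case (step b c)
    then obtain xs where "xs \<noteq> []" "hd xs = a" "last xs = b" "successively P xs"
      "set xs \<subseteq> insert a (Collect (\<lambda>y. \<exists>x. P x y))" by blast
    then show ?case using step
      by (intro exI[of _ "xs @ [c]"]) (auto simp: successively_append_iff)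
  qed
  then show thesis using that by blast
qed

text \<open>From \<open>a\<close>, go to each \<open>u\<close> in turn and back along the reversed
  path, so that the walk built so far always ends at \<open>a\<close>.\<close>

lemma closed_walk_covering:
  assumes "finite W" "symp P" "P a a" "\<And>u. u \<in> W \<Longrightarrow> P\<^sup>*\<^sup>* a u" "\<And>u. u \<in> W \<Longrightarrow> P u u"
  obtains xs where "W \<subseteq> set xs" "successively P xs" "set xs \<subseteq> insert a (Collect (\<lambda>y. \<exists>x. P x y))"
proof -
  have sym: "(\<lambda>x y. P y x) = P" using assms(2) by (intro ext) (auto dest: sympD)
  have "\<exists>xs. xs \<noteq> [] \<and> hd xs = a \<and> last xs = a \<and> W \<subseteq> set xs \<and> successively P xs \<and>
      set xs \<subseteq> insert a (Collect (\<lambda>y. \<exists>x. P x y))"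
    using assms(1,4,5)
  proof (induction W rule: finite_induct)
    case empty
    show ?case by (rule exI[of _ "[a]"]) simp
  next
    case (insert u W)
    then obtain xs where xs: "xs \<noteq> []" "hd xs = a" "last xs = a" "W \<subseteq> set xs" "successively P xs"
      "set xs \<subseteq> insert a (Collect (\<lambda>y. \<exists>x. P x y))"
      by auto
    obtain ys where ys: "ys \<noteq> []" "hd ys = a" "last ys = u" "successively P ys"
      "set ys \<subseteq> insert a (Collect (\<lambda>y. \<exists>x. P x y))"
      by (rule successively_of_rtranclp[OF insert.prems(1)[of u]]) auto
    have "u \<in> set ys" using ys by auto
    \<comment> \<open>The two joints repeat \<open>a\<close> and \<open>u\<close>, which reflexivity
      at these points permits.\<close>
    moreover have "successively P (xs @ ys @ rev ys)"
    proof -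
      have "successively P (rev ys)" using ys(4) unfolding successively_rev sym .
      moreover have "P u u" using insert.prems(2) by simp
      ultimately show ?thesis using xs ys assms(3)
        by (simp add: successively_append_iff hd_append hd_rev)
    qed
    ultimately show ?case using xs ys
      by (intro exI[of _ "xs @ ys @ rev ys"]) (auto simp: last_rev)
  qed
  then show thesis using that by blast
qed

text \<open>If some cell were not reachable from \<open>D0\<close>, the open
  \<open>r\<close>-neighbourhoods of the reachable cells and of the remaining ones would cover the
  support and both meet it. By connectedness they would share a point, and this point joins a
  reachable cell to an unreachable one.\<close>

lemma walk_through_cells:
  fixes \<mu> :: "'a::metric_space measure"
  assumes \<mu>: "metric_prob_space \<mu>" "connected (spt \<mu>)" and \<rho>: "0 < \<rho>"
  obtains Ds :: "'a set list" where "disjoint (set Ds)" "set Ds \<subseteq> sets borel"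
    "\<And>D. D \<in> set Ds \<Longrightarrow> 0 < measure \<mu> D" "measure \<mu> (\<Union>(set Ds)) = 1"
    "successively (\<lambda>D D'. \<forall>x\<in>D. \<forall>y\<in>D'. dist x y \<le> \<rho>) Ds"
    "\<And>D x y. D \<in> set Ds \<Longrightarrow> x \<in> D \<Longrightarrow> y \<in> D \<Longrightarrow> dist x y \<le> \<rho>"
proof -
  interpret prob_space \<mu> using \<mu> by (simp add: metric_prob_space_def)
  have sets: "sets \<mu> = sets borel" using \<mu> by (simp add: metric_prob_space_def)
  have space: "space \<mu> = UNIV" using sets_eq_imp_space_eq[OF sets] by simp
  \<comment> \<open>Two cell diameters and two distances to a common point, each below
    \<open>r\<close>, add up to at most \<open>\<rho>\<close>.\<close>
  define r where "r = \<rho> / 4"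
  have r: "0 < r" "4 * r = \<rho>" using \<rho> by (auto simp: r_def)
  obtain V :: "'a set set" where V: "finite V" "disjoint V" "V \<subseteq> sets borel"
    "\<And>D. D \<in> V \<Longrightarrow> 0 < measure \<mu> D" "measure \<mu> (\<Union>V) = 1"
    "\<And>D x y. D \<in> V \<Longrightarrow> x \<in> D \<Longrightarrow> y \<in> D \<Longrightarrow> dist x y < r"
    using finite_small_cells[OF \<mu>(1) r(1)] by metis
  have UV: "\<Union>V \<in> sets \<mu>" using V(1,3) sets by (intro sets.finite_Union) auto
  \<comment> \<open>The cells have full measure, and a ball around a point of the support has
    positive measure; so the two cannot be disjoint.\<close>
  have spt_V: "\<exists>D\<in>V. \<exists>y\<in>D. dist y x < r" if x: "x \<in> spt \<mu>" for x
  proof (rule ccontr)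
    assume "\<not> ?thesis"
    then have "ball x r \<inter> \<Union>V = {}" by (auto simp: dist_commute)
    then have "measure \<mu> (ball x r \<union> \<Union>V) = measure \<mu> (ball x r) + measure \<mu> (\<Union>V)"
      by (intro finite_measure_Union UV) (simp_all add: sets)
    then have "measure \<mu> (ball x r) + measure \<mu> (\<Union>V) \<le> 1"
      using prob_le_1[of "ball x r \<union> \<Union>V"] by linarith
    then have "measure \<mu> (ball x r) = 0" using V(5) measure_nonneg[of \<mu> "ball x r"] by linarith
    moreover have "0 < emeasure \<mu> (ball x r)" using x r(1) by (auto simp: spt_def)
    ultimately show False by (simp add: emeasure_eq_measure)
  qed
  define P where "P D D' \<longleftrightarrow> D \<in> V \<and> D' \<in> V \<and> (\<forall>x\<in>D. \<forall>y\<in>D'. dist x y \<le> \<rho>)" for D D' :: "'a set"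
  have P_refl: "P D D" if "D \<in> V" for D
    using V(6)[OF that] r \<rho> that by (force simp: P_def)
  have P_sym: "symp P"
    unfolding P_def by (rule sympI) (metis dist_commute)
  have P_close: "P D D'" if "D \<in> V" "D' \<in> V" "x \<in> D" "y \<in> D'" "dist x z < r" "dist y z < r" for D D' x y z
    unfolding P_def
  proof (intro conjI ballI that)
    fix x' y' assume "x' \<in> D" "y' \<in> D'"
    then have "dist x' x < r" "dist y y' < r" using V(6) that by auto
    moreover have "dist x' y' \<le> dist x' x + dist x y'" "dist x y' \<le> dist x z + dist z y'"
      "dist z y' \<le> dist y z + dist y y'"
      using dist_triangle[of x' y' x] dist_triangle[of x y' z] dist_triangle[of z y' y]
      by (simp_all add: dist_commute)
    ultimately show "dist x' y' \<le> \<rho>" using that(5,6) r by linarith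
  qed
  have "V \<noteq> {}" using V(5) by auto
  then obtain D0 where D0: "D0 \<in> V" by auto
  define W where "W = {D \<in> V. P\<^sup>*\<^sup>* D0 D}"
  define nb where "nb \<D> = (\<Union>D\<in>\<D>. \<Union>x\<in>D. ball x r)" for \<D> :: "'a set set"
  have nb_open: "open (nb \<D>)" for \<D> by (auto simp: nb_def)
  have nb_spt: "nb \<D> \<inter> spt \<mu> \<noteq> {}" if \<D>: "\<D> \<subseteq> V" "\<D> \<noteq> {}" for \<D>
  proof -
    obtain D where D: "D \<in> \<D>" using \<D> by auto
    then obtain x where x: "x \<in> D" "x \<in> spt \<mu>"
      using support_meets[OF \<mu>(1), of D] V(3,4) \<D> sets by blast
    have "x \<in> ball x r" using r(1) by simp
    then have "x \<in> nb \<D>" using D x(1) unfolding nb_def by blast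
    then show ?thesis using x(2) by blast
  qed
  have WV: "W = V"
  proof (rule ccontr)
    assume "W \<noteq> V"
    then have ne: "V - W \<noteq> {}" "W \<noteq> {}" using D0 by (auto simp: W_def)
    have "spt \<mu> \<subseteq> nb W \<union> nb (V - W)"
      using spt_V by (fastforce simp: nb_def)
    moreover have "nb W \<inter> spt \<mu> \<noteq> {}"
      by (rule nb_spt) (use ne in \<open>auto simp: W_def\<close>)
    moreover have "nb (V - W) \<inter> spt \<mu> \<noteq> {}"
      by (rule nb_spt) (use ne in auto)
    ultimately have "nb W \<inter> nb (V - W) \<inter> spt \<mu> \<noteq> {}"
      using \<mu>(2) nb_open unfolding connected_def by metis
    then obtain z where "z \<in> nb W" "z \<in> nb (V - W)" by blast
    then obtain D x D' y where *: "D \<in> W" "x \<in> D" "dist x z < r" "D' \<in> V - W" "y \<in> D'" "dist y z < r"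
      unfolding nb_def by auto
    then have "P D D'" by (intro P_close[of D D' x y z]) (simp_all add: W_def)
    then show False using *(1,4) rtranclp.rtrancl_into_rtrancl[of P D0 D D'] by (simp add: W_def)
  qed
  obtain Ds where Ds: "V \<subseteq> set Ds" "successively P Ds" "set Ds \<subseteq> insert D0 (Collect (\<lambda>D'. \<exists>D. P D D'))"
    by (rule closed_walk_covering[OF V(1) P_sym P_refl[OF D0]])
      (use WV P_refl in \<open>auto simp: W_def\<close>)
  have Ds_V: "set Ds = V" using Ds(1,3) D0 by (auto simp: P_def)
  show thesis
  proof (rule that[of Ds])
    show "successively (\<lambda>D D'. \<forall>x\<in>D. \<forall>y\<in>D'. dist x y \<le> \<rho>) Ds"
      using Ds(2) by (rule successively_mono) (simp add: P_def)
    show "dist x y \<le> \<rho>" if "D \<in> set Ds" "x \<in> D" "y \<in> D" for D x y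
      using V(6)[of D x y] that r \<rho> Ds_V by simp
  qed (use V in \<open>auto simp: Ds_V\<close>)
qed

section \<open>From the path back to the metric probability space\<close>

text \<open>The walk may revisit a cell, so \<open>\<pi>\<close> need not be injective: disjointness
  concerns different cells rather than different indices, and the mass of a cell is the sum over its
  visits. The two steps in \<open>cell_close\<close> match the two blocks in
  \<open>smooth_less_1D\<close>.\<close>

locale cell_walk = block_path n R p for n R :: nat and p :: "nat \<Rightarrow> real" +
  fixes \<mu> :: "'a::metric_space measure" and \<pi> :: "nat \<Rightarrow> 'a set" and \<rho> :: real and N :: nat
  assumes mps: "metric_prob_space \<mu>"
    and cell_sets: "i < n \<Longrightarrow> \<pi> i \<in> sets borel"
    and cell_disjoint: "i < n \<Longrightarrow> j < n \<Longrightarrow> \<pi> i \<noteq> \<pi> j \<Longrightarrow> \<pi> i \<inter> \<pi> j = {}"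
    and cell_ne: "i < n \<Longrightarrow> \<pi> i \<noteq> {}"
    and cells_cover: "measure \<mu> (\<Union>i<n. \<pi> i) = 1"
    and cell_weight: "i < n \<Longrightarrow> (\<Sum>k | k < n \<and> \<pi> k = \<pi> i. p k) = measure \<mu> (\<pi> i)"
    and cell_close: "i < n \<Longrightarrow> j < n \<Longrightarrow> i \<le> j + 2 \<Longrightarrow> j \<le> i + 2 \<Longrightarrow> x \<in> \<pi> i \<Longrightarrow> y \<in> \<pi> j \<Longrightarrow> dist x y \<le> \<rho>"
begin

lemma sets_mu: "sets \<mu> = sets borel"
  using mps by (simp add: metric_prob_space_def)

lemma space_mu: "space \<mu> = UNIV"
  using sets_eq_imp_space_eq[OF sets_mu] by simp

sublocale prob_space \<mu>
  using mps by (simp add: metric_prob_space_def)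

definition over :: "nat set \<Rightarrow> (nat \<Rightarrow> 'a) \<Rightarrow> (nat \<Rightarrow> nat) \<Rightarrow> bool" where
  "over J x y \<longleftrightarrow> (\<forall>k\<in>J. y k < L \<and> x k \<in> \<pi> (y k div R))"

text \<open>All lifts of a point to the path are kept, whichever visits they use, so that
  \<open>smooth (code A) js\<close> vanishes on every lift of a point of \<open>A\<close>.\<close>

definition code :: "(nat \<Rightarrow> 'a) set \<Rightarrow> (nat \<Rightarrow> nat) set" where
  "code A = {y. \<exists>x\<in>A. over {1..N} x y}"

text \<open>The form of the sets \<open>A'\<close> and \<open>B'\<close>. One lift on
  \<open>S\<close> with small value suffices; the default \<open>0\<close> off \<open>S\<close>
  leaves finitely many lifts, which makes the set a finite union of boxes, hence Borel.\<close>

definition cylinder :: "nat set \<Rightarrow> ((nat \<Rightarrow> nat) \<Rightarrow> real) \<Rightarrow> (nat \<Rightarrow> 'a) set" where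
  "cylinder S g = {x \<in> pow_space N. \<exists>y. over S x y \<and> (\<forall>k. k \<notin> S \<longrightarrow> y k = 0) \<and> g y < 1/2}"

lemma depends_only_on_cylinder: "depends_only_on N S (cylinder S g)"
  unfolding depends_only_on_def cylinder_def over_def by auto

lemma cylinder_borel:
  assumes S: "S \<subseteq> {1..N}"
  shows "cylinder S g \<in> pow_borel N"
proof -
  let ?M = "pow_measure N \<mu>"
  define Y where "Y = {y. (\<forall>k\<in>S. y k < L) \<and> (\<forall>k. k \<notin> S \<longrightarrow> y k = 0) \<and> g y < 1/2}"
  have fin: "finite S" using S finite_subset by blast
  have "Y \<subseteq> {y. \<forall>k. (k \<in> S \<longrightarrow> y k \<in> {..<L}) \<and> (k \<notin> S \<longrightarrow> y k = 0)}"
    by (auto simp: Y_def)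
  then have "finite Y" by (rule finite_subset) (intro finite_set_of_finite_funs fin finite_lessThan)
  have space: "space ?M = pow_space N"
    by (simp add: pow_measure_def space_PiM space_mu pow_space_def)
  have "cylinder S g = (\<Union>y\<in>Y. {x \<in> space ?M. \<forall>k\<in>S. x k \<in> \<pi> (y k div R)})"
    unfolding cylinder_def over_def Y_def space by auto
  also have "\<dots> \<in> sets ?M"
  proof (intro sets.finite_UN \<open>finite Y\<close> sets.sets_Collect_finite_All fin)
    fix y k assume y: "y \<in> Y" and k: "k \<in> S"
    have "\<pi> (y k div R) \<in> sets \<mu>"
      unfolding sets_mu by (rule cell_sets) (use y k in \<open>auto simp: Y_def div_less_n\<close>)
    moreover have "(\<lambda>x. x k) \<in> measurable ?M \<mu>"
      unfolding pow_measure_def by (rule measurable_component_singleton) (use k S in auto)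
    ultimately show "{x \<in> space ?M. x k \<in> \<pi> (y k div R)} \<in> sets ?M"
      using measurable_sets[of "\<lambda>x. x k" ?M \<mu> "\<pi> (y k div R)"] by (simp add: vimage_def Int_def conj_commute)
  qed
  finally show ?thesis unfolding sets_pow_measure[OF mps] .
qed

lemma sum_w_cell:
  assumes "i < n"
  shows "(\<Sum>b | b < L \<and> \<pi> (b div R) = \<pi> i. w b) = measure \<mu> (\<pi> i)"
proof -
  have "(\<Sum>b | b < L \<and> \<pi> (b div R) = \<pi> i. w b) = (\<Sum>b<L. if \<pi> (b div R) = \<pi> i then w b else 0)"
    by (rule sum.mono_neutral_cong_left) auto
  also have "\<dots> = (\<Sum>m<n. \<Sum>b=m*R..<m*R+R. if \<pi> m = \<pi> i then w b else 0)"
    unfolding sum_blocks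
    by (intro sum.cong refl) (simp add: in_block_iff del: atLeastLessThan_iff)
  also have "\<dots> = (\<Sum>m<n. if \<pi> m = \<pi> i then p m else 0)"
    by (intro sum.cong refl) (simp add: sum_w_block)
  also have "\<dots> = (\<Sum>k | k < n \<and> \<pi> k = \<pi> i. p k)"
    by (rule sum.mono_neutral_cong_right) auto
  finally show ?thesis using cell_weight[OF assms] by simp
qed

text \<open>Up to a null set, \<open>E\<close> is covered by the boxes of cells that meet it. The
  measure of such a box is the total weight of its lifts, and each of these lies over a point of
  \<open>E\<close> in the box, so that \<open>h \<ge> 1\<close> there.\<close>

lemma measure_le_avl:
  assumes E: "E \<in> sets (pow_measure N \<mu>)" and js: "distinct js" "set js = {1..N}"
    and h: "\<And>y. 0 \<le> h y" "\<And>x y. x \<in> E \<Longrightarrow> over {1..N} x y \<Longrightarrow> (\<And>k. k \<notin> {1..N} \<Longrightarrow> y k = 0) \<Longrightarrow> 1 \<le> h y"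
  shows "measure (pow_measure N \<mu>) E \<le> avl js h (\<lambda>_. 0)"
proof -
  let ?I = "{1..N}" and ?M = "pow_measure N \<mu>"
  interpret P: finite_product_prob_space "\<lambda>_. \<mu>" ?I
    by unfold_locales auto
  interpret M: prob_space ?M
    unfolding pow_measure_def by (rule P.P.prob_space_axioms)
  have box: "PiE ?I v \<in> sets ?M" if "\<And>k. k \<in> ?I \<Longrightarrow> v k \<in> sets \<mu>" for v
    unfolding pow_measure_def by (rule sets_PiM_I_finite) (use that in auto)
  have box_measure: "measure ?M (PiE ?I v) = (\<Prod>k\<in>?I. measure \<mu> (v k))"
    if "\<And>k. k \<in> ?I \<Longrightarrow> v k \<in> sets \<mu>" for v
    unfolding pow_measure_def by (rule P.finite_measure_PiM_emb) (rule that)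
  define U where "U = (\<Union>i<n. \<pi> i)"
  have U: "U \<in> sets \<mu>" unfolding U_def sets_mu by (intro sets.finite_UN) (auto intro: cell_sets)
  define G where "G = PiE ?I (\<lambda>_. U)"
  have G: "G \<in> sets ?M" "measure ?M G = 1"
    using box[of "\<lambda>_. U"] box_measure[of "\<lambda>_. U"] U cells_cover by (auto simp: G_def U_def)
  define V where "V = \<pi> ` {..<n}"
  define W where "W = {v \<in> PiE ?I (\<lambda>_. V). PiE ?I v \<inter> E \<noteq> {}}"
  have V_sets: "D \<in> sets \<mu>" if "D \<in> V" for D using that cell_sets by (auto simp: V_def sets_mu)
  have W_sets: "v k \<in> V" if "v \<in> W" "k \<in> ?I" for v k
    using that by (auto simp: W_def PiE_iff)
  have finW: "finite W"
    unfolding W_def by (rule finite_subset[of _ "PiE ?I (\<lambda>_. V)"]) (auto intro!: finite_PiE simp: V_def)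
  have E_space: "E \<subseteq> space ?M" using E by (rule sets.sets_into_space)
  have "E \<inter> G \<subseteq> (\<Union>v\<in>W. PiE ?I v)"
  proof
    fix x assume x: "x \<in> E \<inter> G"
    then have "\<forall>k\<in>?I. \<exists>D\<in>V. x k \<in> D" by (auto simp: G_def U_def V_def PiE_iff)
    then obtain v where v: "\<And>k. k \<in> ?I \<Longrightarrow> v k \<in> V \<and> x k \<in> v k" by metis
    have "x \<in> PiE ?I (restrict v ?I)" using x v by (auto simp: G_def PiE_iff)
    moreover from this have "restrict v ?I \<in> W" using x v by (auto simp: W_def)
    ultimately show "x \<in> (\<Union>v\<in>W. PiE ?I v)" by blast
  qed
  define B where "B D = {b. b < L \<and> \<pi> (b div R) = D}" for D
  define wt where "wt z = (\<Prod>k\<in>?I. w (z k))" for z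
  define ext where "ext z k = (if k \<in> ?I then z k else 0)" for z :: "nat \<Rightarrow> nat" and k
  have wt0: "0 \<le> wt z" if "z \<in> PiE ?I (\<lambda>_. {..<L})" for z
    unfolding wt_def using that by (intro prod_nonneg w_nonneg) (auto simp: PiE_iff)
  have "measure ?M E \<le> measure ?M ((\<Union>v\<in>W. PiE ?I v) \<union> (space ?M - G))"
    using \<open>E \<inter> G \<subseteq> _\<close> E_space
    by (intro M.finite_measure_mono sets.Un sets.finite_UN finW box V_sets W_sets sets.Diff sets.top G) auto
  also have "\<dots> \<le> measure ?M (\<Union>v\<in>W. PiE ?I v) + measure ?M (space ?M - G)"
    by (intro measure_Un_le sets.finite_UN finW box V_sets W_sets sets.Diff sets.top G)
  also have "measure ?M (space ?M - G) = 0"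
    using M.prob_compl[OF G(1)] G(2) by simp
  also have "measure ?M (\<Union>v\<in>W. PiE ?I v) \<le> (\<Sum>v\<in>W. measure ?M (PiE ?I v))"
    by (rule measure_UNION_le[OF finW]) (intro box V_sets W_sets)
  also have "(\<Sum>v\<in>W. measure ?M (PiE ?I v)) = (\<Sum>v\<in>W. \<Sum>z\<in>PiE ?I (\<lambda>k. B (v k)). wt z)"
  proof (rule sum.cong[OF refl])
    fix v assume v: "v \<in> W"
    have "measure ?M (PiE ?I v) = (\<Prod>k\<in>?I. measure \<mu> (v k))"
      by (intro box_measure V_sets W_sets v)
    also have "\<dots> = (\<Prod>k\<in>?I. \<Sum>b\<in>B (v k). w b)"
    proof (rule prod.cong[OF refl])
      fix k assume "k \<in> ?I"
      then obtain i where "i < n" "v k = \<pi> i" using W_sets[OF v] by (auto simp: V_def)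
      then show "measure \<mu> (v k) = (\<Sum>b\<in>B (v k). w b)" using sum_w_cell by (simp add: B_def)
    qed
    also have "\<dots> = (\<Sum>z\<in>PiE ?I (\<lambda>k. B (v k)). wt z)"
      unfolding wt_def by (rule prod_sum_PiE) (auto simp: B_def)
    finally show "measure ?M (PiE ?I v) = (\<Sum>z\<in>PiE ?I (\<lambda>k. B (v k)). wt z)" .
  qed
  also have "\<dots> \<le> (\<Sum>v\<in>W. \<Sum>z\<in>PiE ?I (\<lambda>k. B (v k)). wt z * h (ext z))"
  proof (intro sum_mono)
    fix v z assume v: "v \<in> W" and z: "z \<in> PiE ?I (\<lambda>k. B (v k))"
    obtain x where x: "x \<in> PiE ?I v" "x \<in> E" using v by (auto simp: W_def)
    have "over ?I x (ext z)"
      using x(1) z by (auto simp: over_def ext_def B_def PiE_iff)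
    then have "1 \<le> h (ext z)" by (rule h(2)[OF x(2)]) (auto simp: ext_def)
    moreover have "0 \<le> wt z" by (rule wt0) (use z in \<open>auto simp: B_def PiE_iff\<close>)
    ultimately show "wt z \<le> wt z * h (ext z)" using mult_left_mono[of 1 "h (ext z)" "wt z"] by simp
  qed
  \<comment> \<open>A lift determines its box, so different boxes have disjoint sets of
    lifts.\<close>
  also have "\<dots> = (\<Sum>z\<in>(\<Union>v\<in>W. PiE ?I (\<lambda>k. B (v k))). wt z * h (ext z))"
  proof (rule sum.UNION_disjoint[symmetric, OF finW])
    show "\<forall>v\<in>W. finite (PiE ?I (\<lambda>k. B (v k)))" by (intro ballI finite_PiE) (auto simp: B_def)
    show "\<forall>v\<in>W. \<forall>v'\<in>W. v \<noteq> v' \<longrightarrow> PiE ?I (\<lambda>k. B (v k)) \<inter> PiE ?I (\<lambda>k. B (v' k)) = {}"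
    proof (intro ballI impI)
      fix v v' assume v: "v \<in> W" "v' \<in> W" "v \<noteq> v'"
      then obtain k where "k \<in> ?I" "v k \<noteq> v' k"
        using PiE_ext[of v ?I "\<lambda>_. V" v'] by (auto simp: W_def)
      then show "PiE ?I (\<lambda>k. B (v k)) \<inter> PiE ?I (\<lambda>k. B (v' k)) = {}"
        by (fastforce simp: B_def PiE_iff)
    qed
  qed
  also have "\<dots> \<le> (\<Sum>z\<in>PiE ?I (\<lambda>_. {..<L}). wt z * h (ext z))"
    by (intro sum_mono2 finite_PiE mult_nonneg_nonneg wt0 h) (auto simp: B_def PiE_iff)
  also have "\<dots> = avl js h (\<lambda>_. 0)"
    unfolding avl_eq_sum[OF js(1)] js(2) wt_def ext_def ..
  finally show ?thesis by simp
qed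

text \<open>Over a point of \<open>A\<close> outside the cylinder, every lift has
  \<open>f = 0\<close> and \<open>avl ts f \<ge> 1/2\<close>, so
  \<open>4 * (f - avl ts f)\<^sup>2 \<ge> 1\<close>. This is Chebyshev's inequality, transferred by
  \<open>measure_le_avl\<close>.\<close>

lemma measure_diff_cylinder_le:
  assumes A: "A \<in> pow_borel N" and S: "S \<subseteq> {1..N}"
    and js: "distinct js" "set js = {1..N}" and ts: "set ts = {1..N} - S"
  defines "f \<equiv> smooth (code A) js"
  shows "measure (pow_measure N \<mu>) (A - cylinder S (avl ts f))
    \<le> 4 * avl js (\<lambda>y. (f y - avl ts f y)\<^sup>2) (\<lambda>_. 0)"
proof -
  let ?E = "A - cylinder S (avl ts f)"
  have A_sub: "A \<subseteq> pow_space N"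
  proof -
    have "A \<in> sets (pow_measure N \<mu>)" using A sets_pow_measure[OF mps] by simp
    then show ?thesis
      using sets.sets_into_space by (fastforce simp: pow_measure_def space_PiM space_mu pow_space_def)
  qed
  have "measure (pow_measure N \<mu>) ?E \<le> avl js (\<lambda>y. 4 * (f y - avl ts f y)\<^sup>2) (\<lambda>_. 0)"
  proof (rule measure_le_avl[OF _ js])
    show "?E \<in> sets (pow_measure N \<mu>)"
      using A cylinder_borel[OF S] sets_pow_measure[OF mps] by (metis sets.Diff)
    show "1 \<le> 4 * (f y - avl ts f y)\<^sup>2" if x: "x \<in> ?E" and y: "over {1..N} x y" "\<And>k. k \<notin> {1..N} \<Longrightarrow> y k = 0" for x y
    proof -
      have "f y = 0" unfolding f_def
        by (rule smooth_eq_0) (use x y in \<open>auto simp: code_def\<close>)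
      \<comment> \<open>The cylinder refers to lifts that are \<open>0\<close> off \<open>S\<close>;
        \<open>avl ts\<close> does not see the coordinates that change here.\<close>
      define y' where "y' k = (if k \<in> S then y k else 0)" for k
      have "avl ts f y' = avl ts f y"
        by (rule avl_cong_outside) (use ts y(2) in \<open>auto simp: y'_def\<close>)
      moreover have "over S x y'" using y(1) S by (auto simp: over_def y'_def)
      moreover have "y' k = 0" if "k \<notin> S" for k using that by (simp add: y'_def)
      ultimately have "1/2 \<le> avl ts f y"
        using x A_sub by (force simp: cylinder_def)
      then have "(1/2)\<^sup>2 \<le> (avl ts f y)\<^sup>2" by (intro power_mono) auto
      then show ?thesis using \<open>f y = 0\<close> by (simp add: power2_eq_square)
    qed
  qed simp
  then show ?thesis by (simp add: avl_cmult)
qed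

text \<open>Both averages are below \<open>1/2\<close>, so some common completion \<open>z\<close>
  off \<open>S\<close> keeps both functions below \<open>1\<close> and yields \<open>a\<close> in
  \<open>A\<close> and \<open>b\<close> in \<open>B\<close> near the two completed points. Take a
  coordinate where they are \<open>\<delta>\<close> apart. In \<open>S\<close> they are close to
  \<open>x\<close> and \<open>y\<close> there; off \<open>S\<close> both are close to one point of
  the cell of \<open>z\<close>, which forces \<open>\<delta> \<le> 2 * \<rho>\<close>.\<close>

lemma cylinder_dist:
  assumes js: "set js = {1..N}" and ts: "distinct ts" "set ts = {1..N} - S" and S: "S \<subseteq> {1..N}"
    and sep: "\<And>a b. a \<in> A \<Longrightarrow> b \<in> B \<Longrightarrow> \<exists>k\<in>{1..N}. \<delta> \<le> dist (a k) (b k)"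
    and x: "x \<in> cylinder S (avl ts (smooth (code A) js))"
    and y: "y \<in> cylinder S (avl ts (smooth (code B) js))"
  shows "\<delta> \<le> 2 * \<rho> \<or> (\<exists>k\<in>{1..N}. \<delta> - 2 * \<rho> \<le> dist (x k) (y k))"
proof -
  let ?f = "smooth (code A) js" and ?g = "smooth (code B) js"
  obtain s where s: "over S x s" "avl ts ?f s < 1/2" using x by (auto simp: cylinder_def)
  obtain t where t: "over S y t" "avl ts ?g t < 1/2" using y by (auto simp: cylinder_def)
  define mix where "mix z u k = (if k \<in> set ts then z k else u k)" for z u :: "nat \<Rightarrow> nat" and k
  let ?Z = "PiE (set ts) (\<lambda>_. {..<L})"
  define wt where "wt z = (\<Prod>k\<in>set ts. w (z k))" for z
  have wt0: "0 \<le> wt z" if "z \<in> ?Z" for z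
    unfolding wt_def using that by (intro prod_nonneg w_nonneg) (auto simp: PiE_iff)
  have avl: "avl ts h u = (\<Sum>z\<in>?Z. wt z * h (mix z u))" for h u
    unfolding avl_eq_sum[OF ts(1)] wt_def mix_def ..
  have "\<exists>z\<in>?Z. ?f (mix z s) + ?g (mix z t) < 1"
  proof (rule ccontr)
    assume "\<not> ?thesis"
    then have "(\<Sum>z\<in>?Z. wt z * 1) \<le> (\<Sum>z\<in>?Z. wt z * (?f (mix z s) + ?g (mix z t)))"
      by (intro sum_mono mult_left_mono wt0) (simp_all add: not_less)
    also have "\<dots> = avl ts ?f s + avl ts ?g t"
      unfolding avl by (simp add: distrib_left sum.distrib)
    finally show False
      using avl[of "\<lambda>_. 1" s] s t by (simp add: avl_const)
  qed
  then obtain z where z: "z \<in> ?Z" "?f (mix z s) + ?g (mix z t) < 1" by blast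
  then have "?f (mix z s) < 1" "?g (mix z t) < 1"
    using smooth_bounds(1)[of "code A" js "mix z s"] smooth_bounds(1)[of "code B" js "mix z t"] by linarith+
  then obtain \<alpha> \<beta> where
    \<alpha>: "\<alpha> \<in> code A" "\<And>k. k \<in> {1..N} \<Longrightarrow> mix z s k div R \<le> \<alpha> k div R + 2 \<and> \<alpha> k div R \<le> mix z s k div R + 2" and
    \<beta>: "\<beta> \<in> code B" "\<And>k. k \<in> {1..N} \<Longrightarrow> mix z t k div R \<le> \<beta> k div R + 2 \<and> \<beta> k div R \<le> mix z t k div R + 2"
    using smooth_less_1D js by metis
  obtain a b where ab: "a \<in> A" "over {1..N} a \<alpha>" "b \<in> B" "over {1..N} b \<beta>"
    using \<alpha>(1) \<beta>(1) by (auto simp: code_def)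
  obtain k where k: "k \<in> {1..N}" "\<delta> \<le> dist (a k) (b k)" using sep ab by blast
  have a: "dist c (a k) \<le> \<rho>" if "mix z s k < L" "c \<in> \<pi> (mix z s k div R)" for c
    using that ab(2) k(1) \<alpha>(2)[OF k(1)]
    by (intro cell_close[of "mix z s k div R" "\<alpha> k div R"]) (auto simp: over_def div_less_n)
  have b: "dist c (b k) \<le> \<rho>" if "mix z t k < L" "c \<in> \<pi> (mix z t k div R)" for c
    using that ab(4) k(1) \<beta>(2)[OF k(1)]
    by (intro cell_close[of "mix z t k div R" "\<beta> k div R"]) (auto simp: over_def div_less_n)
  show ?thesis
  proof (cases "k \<in> S")
    case True
    then have "mix z s k = s k" "mix z t k = t k" using ts by (auto simp: mix_def)
    then have "dist (x k) (a k) \<le> \<rho>" "dist (y k) (b k) \<le> \<rho>"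
      using a[of "x k"] b[of "y k"] s(1) t(1) True by (auto simp: over_def)
    moreover have "dist (a k) (b k) \<le> dist (x k) (a k) + dist (x k) (y k) + dist (y k) (b k)"
      using dist_triangle[of "a k" "b k" "x k"] dist_triangle[of "x k" "b k" "y k"]
      by (simp add: dist_commute)
    ultimately have "\<delta> - 2 * \<rho> \<le> dist (x k) (y k)" using k(2) by linarith
    then show ?thesis using k(1) by blast
  next
    case False
    then have mix: "mix z s k = z k" "mix z t k = z k" "z k < L"
      using ts k(1) z(1) by (auto simp: mix_def PiE_iff)
    then obtain c where "c \<in> \<pi> (z k div R)" using cell_ne[OF div_less_n] by blast
    then have "dist c (a k) \<le> \<rho>" "dist c (b k) \<le> \<rho>" using a[of c] b[of c] mix by auto
    then have "dist (a k) (b k) \<le> 2 * \<rho>" using dist_triangle3[of "a k" "b k" c] by linarith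
    then show ?thesis using k(2) by linarith
  qed
qed

text \<open>Both sets share one \<open>S\<close>, the union of their coordinates of large mean
  oscillation, whence \<open>2 * C\<close>; all remaining coordinates have small mean oscillation
  for both functions.\<close>

lemma junta_of_separated:
  fixes l Z e :: real
  assumes l: "0 < l" "\<And>i. i < n \<Longrightarrow> l \<le> p i" and N: "N \<le> R"
    and Z: "1 < Z" and e: "0 < e" and C: "C = 1 / l + 1"
    and small: "4 * (Z * (e * C) + 4 * C / (l * ln Z)) < \<epsilon>"
    and A: "A \<in> pow_borel N" and B: "B \<in> pow_borel N"
    and sep: "\<And>a b. a \<in> A \<Longrightarrow> b \<in> B \<Longrightarrow> \<exists>k\<in>{1..N}. \<delta> \<le> dist (a k) (b k)"
  obtains S A' B' where "S \<subseteq> {1..N}" "card S * e \<le> 2 * C" "A' \<in> pow_borel N" "B' \<in> pow_borel N"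
    "depends_only_on N S A'" "depends_only_on N S B'"
    "measure (pow_measure N \<mu>) (A - A') < \<epsilon>" "measure (pow_measure N \<mu>) (B - B') < \<epsilon>"
    "\<And>x y. x \<in> A' \<Longrightarrow> y \<in> B' \<Longrightarrow> \<delta> \<le> 2 * \<rho> \<or> (\<exists>k\<in>{1..N}. \<delta> - 2 * \<rho> \<le> dist (x k) (y k))"
proof -
  have small': "4 * v < \<epsilon>" if "v \<le> Z * (e * C) + 4 * C / (l * ln Z)" for v
    by (rule le_less_trans[OF mult_left_mono[OF that] small]) simp
  define js where "js = [1..<Suc N]"
  have js: "distinct js" "set js = {1..N}" "length js \<le> R" using N by (auto simp: js_def)
  define f where "f X = smooth (code X) js" for X
  have junta: "\<exists>T \<subseteq> {1..N}. card ({1..N} - T) * e \<le> C \<and> (\<forall>ts. set ts \<subseteq> T \<longrightarrow> distinct ts \<longrightarrow>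
     avl js (\<lambda>x. (f X x - avl ts (f X) x)\<^sup>2) (\<lambda>_. 0) \<le> Z * (e * C) + 4 * C / (l * ln Z))" for X
    unfolding f_def js(2)[symmetric] by (rule smooth_junta[OF l js(1,3) Z e C])
  obtain T1 where T1: "T1 \<subseteq> {1..N}" "card ({1..N} - T1) * e \<le> C" "\<And>ts. set ts \<subseteq> T1 \<Longrightarrow> distinct ts \<Longrightarrow>
     avl js (\<lambda>x. (f A x - avl ts (f A) x)\<^sup>2) (\<lambda>_. 0) \<le> Z * (e * C) + 4 * C / (l * ln Z)"
    using junta[of A] by blast
  obtain T2 where T2: "T2 \<subseteq> {1..N}" "card ({1..N} - T2) * e \<le> C" "\<And>ts. set ts \<subseteq> T2 \<Longrightarrow> distinct ts \<Longrightarrow>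
     avl js (\<lambda>x. (f B x - avl ts (f B) x)\<^sup>2) (\<lambda>_. 0) \<le> Z * (e * C) + 4 * C / (l * ln Z)"
    using junta[of B] by blast
  define S where "S = ({1..N} - T1) \<union> ({1..N} - T2)"
  obtain ts where ts: "set ts = {1..N} - S" "distinct ts"
    using finite_distinct_list[of "{1..N} - S"] by auto
  have S: "S \<subseteq> {1..N}" by (auto simp: S_def)
  have ts_sub: "set ts \<subseteq> T1" "set ts \<subseteq> T2" using ts by (auto simp: S_def)
  show thesis
  proof (rule that[of S "cylinder S (avl ts (f A))" "cylinder S (avl ts (f B))"])
    have "card S \<le> card ({1..N} - T1) + card ({1..N} - T2)" unfolding S_def by (rule card_Un_le)
    then have "real (card S) * e \<le> (real (card ({1..N} - T1)) + real (card ({1..N} - T2))) * e"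
      using e by (intro mult_right_mono) auto
    then show "card S * e \<le> 2 * C" using T1(2) T2(2) by (simp add: distrib_right)
    show "measure (pow_measure N \<mu>) (A - cylinder S (avl ts (f A))) < \<epsilon>"
      using measure_diff_cylinder_le[OF A S js(1,2) ts(1)] small'[OF T1(3)[OF ts_sub(1) ts(2)]]
      unfolding f_def by (rule le_less_trans)
    show "measure (pow_measure N \<mu>) (B - cylinder S (avl ts (f B))) < \<epsilon>"
      using measure_diff_cylinder_le[OF B S js(1,2) ts(1)] small'[OF T2(3)[OF ts_sub(2) ts(2)]]
      unfolding f_def by (rule le_less_trans)
    show "\<delta> \<le> 2 * \<rho> \<or> (\<exists>k\<in>{1..N}. \<delta> - 2 * \<rho> \<le> dist (x k) (y k))"
      if "x \<in> cylinder S (avl ts (f A))" "y \<in> cylinder S (avl ts (f B))" for x y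
      using cylinder_dist[OF js(2) ts(2,1) S sep] that unfolding f_def by blast
  qed (rule S cylinder_borel[OF S] depends_only_on_cylinder)+
qed

end

section \<open>The constants and the conclusion\<close>

lemma exists_junta_constants:
  fixes l C \<epsilon> :: real
  assumes "0 < l" "0 < C" "0 < \<epsilon>"
  obtains Z e where "1 < Z" "0 < e" "4 * (Z * (e * C) + 4 * C / (l * ln Z)) < \<epsilon>"
proof
  \<comment> \<open>Both summands in the parentheses become \<open>\<epsilon> / 16\<close>, so that
    the total is \<open>\<epsilon> / 2\<close>.\<close>
  define Z where "Z = exp (64 * C / (l * \<epsilon>))"
  define e where "e = \<epsilon> / (16 * Z * C)"
  show "1 < Z" using assms by (simp add: Z_def)
  show "0 < e" using assms by (simp add: e_def Z_def)
  have "Z * (e * C) = \<epsilon> / 16" using assms by (simp add: e_def Z_def)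
  moreover have "4 * C / (l * ln Z) = \<epsilon> / 16" using assms by (simp add: Z_def)
  ultimately show "4 * (Z * (e * C) + 4 * C / (l * ln Z)) < \<epsilon>"
    using assms(3) by (simp only: distrib_left)
qed

theorem mainTheorem4:
  fixes \<mu> :: "'a::metric_space measure" and \<delta> \<epsilon> :: real
  assumes "metric_prob_space \<mu>"
    and "connected (spt \<mu>)"
    and "locally connected (spt \<mu>)"
    and "\<delta> > 0" and "\<epsilon> > 0"
  shows "\<exists>q::nat. \<forall>N\<ge>1. \<forall>A \<in> pow_borel N. \<forall>B \<in> pow_borel N.
           set_dist_max N A B \<ge> ereal \<delta> \<longrightarrow>
           (\<exists>S A' B'. S \<subseteq> {1..N} \<and> card S \<le> q \<and>
              A' \<in> pow_borel N \<and> B' \<in> pow_borel N \<and>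
              depends_only_on N S A' \<and> depends_only_on N S B' \<and>
              measure (pow_measure N \<mu>) (A - A') < \<epsilon> \<and>
              measure (pow_measure N \<mu>) (B - B') < \<epsilon> \<and>
              set_dist_max N A' B' \<ge> ereal (\<delta> - \<epsilon>))"
proof -
  \<comment> \<open>Points of cells at most two steps apart are within \<open>2 * \<rho>\<close>,
    and this error occurs twice, once for \<open>A\<close> and once for \<open>B\<close>: together
    \<open>4 * \<rho> = \<epsilon>\<close>.\<close>
  define \<rho> where "\<rho> = \<epsilon> / 4"
  have \<rho>: "0 < \<rho>" using \<open>\<epsilon> > 0\<close> by (simp add: \<rho>_def)
  interpret prob_space \<mu> using assms(1) by (simp add: metric_prob_space_def)
  have sets: "sets \<mu> = sets borel" using assms(1) by (simp add: metric_prob_space_def)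
  obtain Ds :: "'a set list" where Ds: "disjoint (set Ds)" "set Ds \<subseteq> sets borel"
    "\<And>D. D \<in> set Ds \<Longrightarrow> 0 < measure \<mu> D" "measure \<mu> (\<Union>(set Ds)) = 1"
    and walk: "successively (\<lambda>D D'. \<forall>x\<in>D. \<forall>y\<in>D'. dist x y \<le> \<rho>) Ds"
    and diam: "\<And>D x y. D \<in> set Ds \<Longrightarrow> x \<in> D \<Longrightarrow> y \<in> D \<Longrightarrow> dist x y \<le> \<rho>"
    using walk_through_cells[OF assms(1,2) \<rho>] by blast
  define n where "n = length Ds"
  define \<pi> where "\<pi> i = Ds ! i" for i
  define visits where "visits i = {k. k < n \<and> \<pi> k = \<pi> i}" for i
  \<comment> \<open>Each visit gets an equal share of the mass of its cell, so every vertex of the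
    path has positive weight.\<close>
  define p where "p i = measure \<mu> (\<pi> i) / card (visits i)" for i
  have \<pi>: "\<pi> i \<in> set Ds" if "i < n" for i using that by (simp add: \<pi>_def n_def)
  have set_Ds: "set Ds = \<pi> ` {..<n}" by (auto simp: \<pi>_def n_def set_conv_nth)
  have fin_visits: "finite (visits i)" for i by (simp add: visits_def)
  have card_visits: "0 < card (visits i)" if "i < n" for i
    using that fin_visits by (auto simp: card_gt_0_iff visits_def)
  have p_pos: "0 < p i" if "i < n" for i
    using Ds(3)[OF \<pi>[OF that]] card_visits[OF that] by (simp add: p_def)
  have weight: "(\<Sum>k | k < n \<and> \<pi> k = \<pi> i. p k) = measure \<mu> (\<pi> i)" if i: "i < n" for i
  proof -
    have "p k = measure \<mu> (\<pi> i) / card (visits i)" if "k \<in> visits i" for k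
      using that by (simp add: p_def visits_def)
    then have "(\<Sum>k\<in>visits i. p k) = (\<Sum>k\<in>visits i. measure \<mu> (\<pi> i) / card (visits i))"
      by (rule sum.cong[OF refl])
    also have "\<dots> = measure \<mu> (\<pi> i)" using card_visits[OF i] by simp
    finally show ?thesis unfolding visits_def .
  qed
  have p_sum: "(\<Sum>i<n. p i) = 1"
  proof -
    have "(\<Sum>i<n. p i) = (\<Sum>D\<in>\<pi> ` {..<n}. \<Sum>i | i \<in> {..<n} \<and> \<pi> i = D. p i)"
      by (rule sum.image_gen) simp
    also have "\<dots> = (\<Sum>D\<in>\<pi> ` {..<n}. measure \<mu> D)"
      by (rule sum.cong[OF refl]) (use weight in auto)
    also have "\<dots> = measure \<mu> (\<Union>D\<in>set Ds. D)"
      unfolding set_Ds[symmetric]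
      by (rule finite_measure_finite_Union[symmetric])
         (use Ds(1,2) in \<open>auto simp: disjoint_def disjoint_family_on_def sets\<close>)
    finally show ?thesis using Ds(4) by simp
  qed
  have n: "0 < n" using p_sum by (cases n) auto
  \<comment> \<open>The walk is chosen before \<open>N\<close>, so \<open>l\<close>, and with it
    \<open>C\<close>, \<open>Z\<close>, \<open>e\<close> and the final bound, do not depend on
    \<open>N\<close>.\<close>
  define l where "l = Min (p ` {..<n})"
  have l: "0 < l" "\<And>i. i < n \<Longrightarrow> l \<le> p i"
  proof -
    show "0 < l" unfolding l_def using n p_pos by (subst Min_gr_iff) auto
    show "l \<le> p i" if "i < n" for i unfolding l_def using that by (intro Min_le) auto
  qed
  define C where "C = 1 / l + 1"
  have C: "0 < C" using l(1) by (simp add: C_def add_pos_pos)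
  obtain Z e where Ze: "1 < Z" "0 < e" "4 * (Z * (e * C) + 4 * C / (l * ln Z)) < \<epsilon>"
    using exists_junta_constants[OF l(1) C \<open>\<epsilon> > 0\<close>] .
  have step: "dist x y \<le> \<rho>" if "Suc i < n" "x \<in> \<pi> i" "y \<in> \<pi> (Suc i)" for i x y
    using walk that unfolding successively_conv_nth \<pi>_def n_def by blast
  have ne: "\<pi> i \<noteq> {}" if "i < n" for i using Ds(3)[OF \<pi>[OF that]] by auto
  have close: "dist x y \<le> 2 * \<rho>" if "j < n" "i \<le> j" "j \<le> i + 2" "x \<in> \<pi> i" "y \<in> \<pi> j" for i j x y
  proof -
    have "j = i \<or> j = Suc i \<or> j = Suc (Suc i)" using that by linarith
    then show ?thesis
    proof (elim disjE)
      assume "j = i"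
      then show ?thesis using diam[OF \<pi>, of j x y] that \<rho> by simp
    next
      assume "j = Suc i"
      then show ?thesis using step[of i x y] that \<rho> by simp
    next
      assume j: "j = Suc (Suc i)"
      then obtain z where "z \<in> \<pi> (Suc i)" using ne[of "Suc i"] \<open>j < n\<close> by auto
      then show ?thesis
        using step[of i x z] step[of "Suc i" z y] dist_triangle[of x y z] that j by simp
    qed
  qed
  show ?thesis
  proof (rule exI[of _ "nat \<lceil>2 * C / e\<rceil>"], intro allI impI ballI)
    fix N :: nat and A B :: "(nat \<Rightarrow> 'a) set" assume N: "1 \<le> N" and AB: "A \<in> pow_borel N" "B \<in> pow_borel N"
      and sep: "ereal \<delta> \<le> set_dist_max N A B"
    \<comment> \<open>Blocks of \<open>R = N\<close> sites are long enough for
      \<open>length js \<le> R\<close>, and the bound on \<open>card S\<close> does not depend on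
      \<open>R\<close>.\<close>
    interpret cell_walk n N p \<mu> \<pi> "2 * \<rho>" N
    proof unfold_locales
      show "dist x y \<le> 2 * \<rho>" if "i < n" "j < n" "i \<le> j + 2" "j \<le> i + 2" "x \<in> \<pi> i" "y \<in> \<pi> j" for i j x y
        using close[of j i x y] close[of i j y x] that by (cases "i \<le> j") (auto simp: dist_commute)
      show "\<pi> i \<inter> \<pi> j = {}" if "i < n" "j < n" "\<pi> i \<noteq> \<pi> j" for i j
        using disjointD[OF Ds(1) \<pi> \<pi>] that by simp
      show "measure \<mu> (\<Union>i<n. \<pi> i) = 1" using Ds(4) by (simp add: set_Ds)
    qed (use N p_pos p_sum assms(1) Ds(2) \<pi> ne weight in auto)
    have max_le: "c \<le> dist_max N x y \<longleftrightarrow> (\<exists>k\<in>{1..N}. c \<le> dist (x k) (y k))"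
      for c and x y :: "nat \<Rightarrow> 'a"
      unfolding dist_max_def using N by (subst Max_ge_iff) auto
    have sep': "\<exists>k\<in>{1..N}. \<delta> \<le> dist (a k) (b k)" if "a \<in> A" "b \<in> B" for a b
    proof -
      have "ereal \<delta> \<le> ereal (dist_max N a b)"
        using sep unfolding set_dist_max_def le_Inf_iff using that by blast
      then show ?thesis unfolding ereal_less_eq max_le .
    qed
    obtain S A' B' where S: "S \<subseteq> {1..N}" "card S * e \<le> 2 * C" and *: "A' \<in> pow_borel N" "B' \<in> pow_borel N"
      "depends_only_on N S A'" "depends_only_on N S B'"
      "measure (pow_measure N \<mu>) (A - A') < \<epsilon>" "measure (pow_measure N \<mu>) (B - B') < \<epsilon>"
      and dist: "\<And>x y. x \<in> A' \<Longrightarrow> y \<in> B' \<Longrightarrow>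
        \<delta> \<le> 2 * (2 * \<rho>) \<or> (\<exists>k\<in>{1..N}. \<delta> - 2 * (2 * \<rho>) \<le> dist (x k) (y k))"
      using junta_of_separated[OF l order_refl Ze(1,2) C_def Ze(3) AB sep'] by blast
    have "card S \<le> nat \<lceil>2 * C / e\<rceil>"
    proof -
      have "real (card S) \<le> 2 * C / e" using S(2) Ze(2) by (simp add: le_divide_eq)
      then show ?thesis by linarith
    qed
    moreover have "ereal (\<delta> - \<epsilon>) \<le> set_dist_max N A' B'"
      unfolding set_dist_max_def
    proof (rule Inf_greatest, clarsimp)
      fix x y assume "x \<in> A'" "y \<in> B'"
      then consider "\<delta> \<le> \<epsilon>" | "\<exists>k\<in>{1..N}. \<delta> - \<epsilon> \<le> dist (x k) (y k)"
        using dist[of x y] by (auto simp: \<rho>_def)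
      then have "\<exists>k\<in>{1..N}. \<delta> - \<epsilon> \<le> dist (x k) (y k)"
      proof cases
        \<comment> \<open>For \<open>\<delta> \<le> \<epsilon>\<close> any coordinate will do, and
          \<open>N \<ge> 1\<close> provides coordinate \<open>1\<close>.\<close>
        case 1
        then have "\<delta> - \<epsilon> \<le> dist (x 1) (y 1)" using zero_le_dist[of "x 1" "y 1"] by linarith
        then show ?thesis using N by (intro bexI[of _ 1]) auto
      qed
      then show "\<delta> - \<epsilon> \<le> dist_max N x y" unfolding max_le .
    qed
    ultimately show "\<exists>S A' B'. S \<subseteq> {1..N} \<and> card S \<le> nat \<lceil>2 * C / e\<rceil> \<and>
              A' \<in> pow_borel N \<and> B' \<in> pow_borel N \<and>
              depends_only_on N S A' \<and> depends_only_on N S B' \<and>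
              measure (pow_measure N \<mu>) (A - A') < \<epsilon> \<and>
              measure (pow_measure N \<mu>) (B - B') < \<epsilon> \<and>
              ereal (\<delta> - \<epsilon>) \<le> set_dist_max N A' B'"
      using S(1) * by blast
  qed
qed

end
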